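(* Let $q\ge 3$ be a prime power, $r=\lfloor (q-1)/2\rfloor$, $t=q/r$, and $\gamma=\frac{q}{3r}\left(\frac12-\frac rq\right)^2$. Let $n\ge 1$, let $w:\mathbb{F}_q^n\to[0,\infty)$, and let $S_w=\sum_{\sigma\in\mathbb{F}_q^n}w(\sigma)$. For any $\delta>0$, the MB-WISH algorithm run with parameters $q,r,\delta$ makes $\Theta(n\log\frac n\delta)$ calls to the MAX-oracle, and with probability at least $1-\delta$ its output $\hat Z$ is a $(q/r)^2$-approximation of $S_w$, i.e. $S_w/(q/r)^2\le \hat Z\le (q/r)^2 S_w$.
   Context: Fix an enumeration $\mathbb{F}_q=\{\alpha_0,\alpha_1,\dots,\alpha_{q-1}\}$ and write $\alpha_a<\alpha_b$ iff $a<b$ (this is only an ordering, not related to field arithmetic). For $u,v\in\mathbb{F}_q^m$ write $u<v$ iff $u_j<v_j$ for every coordinate $j$; $\mathbf 1$ denotes the all-ones vector. A MAX-oracle, given $A\in\mathbb{F}_q^{m\times n}$, $b,s\in\mathbb{F}_q^m$, returns exactly $\max\{w(\sigma):\sigma\in\mathbb{F}_q^n,\ A\sigma+b<s\}$ (arithmetic in $\mathbb{F}_q$; the maximum over an empty set is taken as $0$). The MB-WISH algorithm: set $\ell=\lceil \frac1\gamma\ln\frac{2n}{\delta}\rceil$ and $n'=\lceil n\log_{q/r}q\rceil$. Compute $M_0=\max_{\sigma\in\mathbb{F}_q^n}w(\sigma)$. For each $i=1,\dots,n'$ and each $k=1,\dots,\ell$, independently sample $A^{i}\in\mathbb{F}_q^{i\times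 n}$ and $b^{i}\in\mathbb{F}_q^{i}$ with all entries independent and uniform in $\mathbb{F}_q$, and let $w_i^{(k)}=\max\{w(\sigma): A^{i}\sigma+b^{i}<\alpha_r\cdot\mathbf 1\}$ (one oracle call). Let $M_i$ be the median of $w_i^{(1)},\dots,w_i^{(\ell)}$. Output $\hat Z=M_0+\left(\frac qr-1\right)\sum_{i=0}^{n'-1}M_{i+1}\left(\frac qr\right)^i$. *)

theory Defs
  imports
    "HOL-Probability.Product_PMF"
    "HOL-Library.Landau_Symbols"
    "Jordan_Normal_Form.Matrix"
begin

text \<open>
  The field \<open>\<bbbF>\<^sub>q\<close> is a finite field type \<open>'a\<close> with \<open>CARD('a) = q\<close>; an enumeration of it is a
  bijection \<open>\<alpha>\<close> from \<open>{..<q}\<close> onto the type. Vectors and matrices over it are those of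
  \<open>Jordan_Normal_Form\<close>, so that the dimension \<open>n\<close> can be quantified inside a formula.
\<close>

definition enum_less :: "(nat \<Rightarrow> 'a::finite) \<Rightarrow> 'a \<Rightarrow> 'a \<Rightarrow> bool" where
  "enum_less \<alpha> x y \<longleftrightarrow> (\<exists>a b. a < b \<and> b < CARD('a) \<and> x = \<alpha> a \<and> y = \<alpha> b)"

definition enum_vec_less :: "(nat \<Rightarrow> 'a::finite) \<Rightarrow> 'a Matrix.vec \<Rightarrow> 'a Matrix.vec \<Rightarrow> bool" where
  "enum_vec_less \<alpha> u v \<longleftrightarrow>
     dim_vec u = dim_vec v \<and> (\<forall>j<dim_vec u. enum_less \<alpha> (vec_index u j) (vec_index v j))"

definition ones_vec :: "nat \<Rightarrow> 'a::one Matrix.vec" where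
  "ones_vec m = Matrix.vec m (\<lambda>_. 1)"

definition max_oracle ::
  "(nat \<Rightarrow> 'a::{field,finite}) \<Rightarrow> nat \<Rightarrow> ('a Matrix.vec \<Rightarrow> real) \<Rightarrow>
   'a Matrix.mat \<Rightarrow> 'a Matrix.vec \<Rightarrow> 'a Matrix.vec \<Rightarrow> real" where
  "max_oracle \<alpha> n w A b s =
     (let F = {\<sigma> \<in> carrier_vec n. enum_vec_less \<alpha> (A *\<^sub>v \<sigma> + b) s}
      in if F = {} then 0 else Max (w ` F))"

text \<open>
  For an even number of values the median is the mean of the two middle ones; for an odd number
  both indices below coincide. On the empty list the value is unspecified.
\<close>

definition median :: "real list \<Rightarrow> real" where
  "median xs =
     (let ys = sort xs; k = length xs in (ys ! ((k - 1) div 2) + ys ! (k div 2)) / 2)"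

definition random_mat :: "nat \<Rightarrow> nat \<Rightarrow> 'a::{field,finite} Matrix.mat pmf" where
  "random_mat m n =
     map_pmf (Matrix.mat m n) (Pi_pmf ({..<m} \<times> {..<n}) 0 (\<lambda>_. pmf_of_set UNIV))"

definition random_vec :: "nat \<Rightarrow> 'a::{field,finite} Matrix.vec pmf" where
  "random_vec m = map_pmf (Matrix.vec m) (Pi_pmf {..<m} 0 (\<lambda>_. pmf_of_set UNIV))"

definition wish_gamma :: "nat \<Rightarrow> nat \<Rightarrow> real" where
  "wish_gamma q r = real q / (3 * real r) * (1/2 - real r / real q)\<^sup>2"

definition wish_reps :: "nat \<Rightarrow> nat \<Rightarrow> nat \<Rightarrow> real \<Rightarrow> nat" where
  "wish_reps q r n \<delta> = nat \<lceil>1 / wish_gamma q r * ln (2 * real n / \<delta>)\<rceil>"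

definition wish_levels :: "nat \<Rightarrow> nat \<Rightarrow> nat \<Rightarrow> nat" where
  "wish_levels q r n = nat \<lceil>real n * log (real q / real r) (real q)\<rceil>"

text \<open>
  A randomized computation with access to the oracle is a distribution over pairs of its result
  and the number of oracle calls that it made.
\<close>

definition wish_query ::
  "(nat \<Rightarrow> 'a::{field,finite}) \<Rightarrow> nat \<Rightarrow> nat \<Rightarrow> ('a Matrix.vec \<Rightarrow> real) \<Rightarrow> nat \<Rightarrow> (real \<times> nat) pmf" where
  "wish_query \<alpha> r n w i =
     do {
       A \<leftarrow> random_mat i n;
       b \<leftarrow> random_vec i;
       return_pmf (max_oracle \<alpha> n w A b (\<alpha> r \<cdot>\<^sub>v ones_vec i), 1)
     }"

definition wish_level ::
  "(nat \<Rightarrow> 'a::{field,finite}) \<Rightarrow> nat \<Rightarrow> nat \<Rightarrow> real \<Rightarrow> nat \<Rightarrow> ('a Matrix.vec \<Rightarrow> real) \<Rightarrow> nat \<Rightarrow>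
   (real \<times> nat) pmf" where
  "wish_level \<alpha> q r \<delta> n w i =
     map_pmf (\<lambda>xs. (median (map fst xs), sum_list (map snd xs)))
       (replicate_pmf (wish_reps q r n \<delta>) (wish_query \<alpha> r n w i))"

text \<open>
  \<open>M\<^sub>0\<close> is the oracle's answer for the system without rows, and therefore counts as one call.
\<close>

definition mb_wish ::
  "(nat \<Rightarrow> 'a::{field,finite}) \<Rightarrow> nat \<Rightarrow> nat \<Rightarrow> real \<Rightarrow> nat \<Rightarrow> ('a Matrix.vec \<Rightarrow> real) \<Rightarrow>
   (real \<times> nat) pmf" where
  "mb_wish \<alpha> q r \<delta> n w =
     (let n' = wish_levels q r n; M0 = Max (w ` carrier_vec n)
      in map_pmf
           (\<lambda>L. (M0 + (real q / real r - 1) * (\<Sum>i<n'. fst (L (i + 1)) * (real q / real r) ^ i),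
                 1 + (\<Sum>i=1..n'. snd (L i))))
           (Pi_pmf {1..n'} (0, 0) (wish_level \<alpha> q r \<delta> n w)))"

text \<open>
  The regime \<open>n / \<delta> \<longrightarrow> \<infinity>\<close> (with \<open>n \<ge> 1\<close> and \<open>\<delta> > 0\<close>), jointly in both parameters. It contains
  \<open>n \<longrightarrow> \<infinity>\<close> for fixed \<open>\<delta>\<close> and \<open>\<delta> \<longrightarrow> 0\<close> for fixed \<open>n\<close>. Without it no bound by a multiple of
  \<open>n * ln (n / \<delta>)\<close> is possible, since that vanishes for \<open>\<delta> = n\<close>.
\<close>

definition wish_regime :: "(nat \<times> real) filter" where
  "wish_regime =
     inf (filtercomap (\<lambda>(n, \<delta>). real n / \<delta>) at_top) (principal {(n, \<delta>). n \<ge> 1 \<and> \<delta> > 0})"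

end

theory Submission
  imports Defs
begin

text \<open>
  Put \<open>t = q / r > 2\<close> and let \<open>f 0 \<ge> f 1 \<ge> \<dots>\<close> be the weights in decreasing order. A random affine
  system with \<open>i\<close> rows is satisfied by each \<open>\<sigma>\<close> with probability \<open>t\<^bsup>-i\<^esup>\<close>, pairwise independently.
  By the second moment method one of the \<open>t\<^bsup>i+1\<^esup>\<close> heaviest \<open>\<sigma>\<close> survives except with probability
  \<open>1 / (1 + t)\<close>, and by the union bound none of the \<open>t\<^bsup>i-2\<^esup>\<close> heaviest survives except with
  probability \<open>1 / t\<^sup>2 \<le> 1 / (1 + t)\<close>. If the medians \<open>M\<^sub>i\<close> lie between the weights at the
  ranks \<open>t\<^bsup>i+1\<^esup>\<close> and \<open>t\<^bsup>i-2\<^esup>\<close>, then comparing \<open>S\<^sub>w\<close> with the geometric sum gives the factor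
  \<open>t\<^sup>2\<close> on both sides.

  The rank \<open>t\<^bsup>i-2\<^esup>\<close>, instead of \<open>t\<^bsup>i-1\<^esup>\<close>, matters. With the latter the failure probability
  of a sample is only bounded by \<open>r / q\<close>, which is so close to \<open>1/2\<close> that the repetitions do not pay
  for a union bound over all \<open>n' \<approx> n log\<^sub>t q\<close> levels when \<open>q\<close> is large. With the former both failure
  probabilities stay below \<open>1/3\<close>, so the medians fail with a much smaller probability than
  \<open>\<delta> / (2n)\<close>.
\<close>

section \<open>Geometric sampling of a decreasing sequence\<close>

text \<open>
  The following two definitions describe the integral over \<open>[0, x]\<close> of the step function with
  value \<open>f k\<close> on \<open>[k, k + 1)\<close> for \<open>k < N\<close> and \<open>0\<close> elsewhere.
\<close>

definition overlap :: "real \<Rightarrow> nat \<Rightarrow> real" where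
  "overlap x k = max 0 (min 1 (x - real k))"

definition cumulative :: "(nat \<Rightarrow> real) \<Rightarrow> nat \<Rightarrow> real \<Rightarrow> real" where
  "cumulative f N x = (\<Sum>k<N. f k * overlap x k)"

lemma overlap_mono: "x \<le> y \<Longrightarrow> overlap x k \<le> overlap y k"
  by (auto simp: overlap_def)

lemma sum_overlap: "x \<ge> 0 \<Longrightarrow> (\<Sum>k<N. overlap x k) = min x (real N)"
  by (induction N) (auto simp: overlap_def)

lemma cumulative_le_sum:
  assumes "\<And>k. f k \<ge> 0"
  shows "cumulative f N x \<le> (\<Sum>k<N. f k)"
  unfolding cumulative_def
  by (intro sum_mono mult_left_le) (auto simp: overlap_def assms)

lemma cumulative_eq_sum:
  assumes "x \<ge> real N"
  shows "cumulative f N x = (\<Sum>k<N. f k)"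
  unfolding cumulative_def using assms
  by (intro sum.cong) (auto simp: overlap_def)

lemma cumulative_diff:
  "cumulative f N y - cumulative f N x = (\<Sum>k<N. f k * (overlap y k - overlap x k))"
  by (simp add: cumulative_def sum_subtractf[symmetric] algebra_simps)

text \<open>The integrand decreases, so on \<open>[x, y]\<close> it never exceeds its value at
  \<open>x\<close>, which lies on the step of index \<open>nat \<lfloor>x\<rfloor>\<close>; the
  cut-off at \<open>N\<close> only lowers the integral.\<close>

lemma cumulative_diff_le:
  assumes f: "antimono f" "\<And>k. f k \<ge> 0" and xy: "0 \<le> x" "x \<le> y"
  shows "cumulative f N y - cumulative f N x \<le> (y - x) * f (nat \<lfloor>x\<rfloor>)"
proof -
  have "(\<Sum>k<N. f k * (overlap y k - overlap x k))
        \<le> (\<Sum>k<N. f (nat \<lfloor>x\<rfloor>) * (overlap y k - overlap x k))"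
  proof (rule sum_mono)
    fix k assume "k \<in> {..<N}"
    show "f k * (overlap y k - overlap x k) \<le> f (nat \<lfloor>x\<rfloor>) * (overlap y k - overlap x k)"
    proof (cases "nat \<lfloor>x\<rfloor> \<le> k")
      case True
      then show ?thesis
        using antimonoD[OF f(1) True] overlap_mono[OF xy(2)] by (intro mult_right_mono) auto
    next
      case False
      then have "real k + 1 \<le> x"
        using xy(1) by linarith
      then have "overlap y k - overlap x k = 0"
        using xy by (auto simp: overlap_def)
      then show ?thesis by simp
    qed
  qed
  also have "\<dots> = f (nat \<lfloor>x\<rfloor>) * (min y (real N) - min x (real N))"
    using xy by (simp add: sum_distrib_left[symmetric] sum_subtractf sum_overlap)
  also have "\<dots> \<le> f (nat \<lfloor>x\<rfloor>) * (y - x)"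
    using f(2) xy by (intro mult_left_mono) auto
  finally show ?thesis by (simp add: cumulative_diff mult.commute)
qed

text \<open>On \<open>[x, y)\<close> the integrand is smallest just left of \<open>y\<close>, on the
  step of index \<open>nat \<lceil>y\<rceil> - 1\<close>. Beyond \<open>N\<close> the cut-off does
  no harm, since the sampled value is then \<open>0\<close>.\<close>

lemma cumulative_diff_ge:
  assumes f: "antimono f" "\<And>k. k \<ge> N \<Longrightarrow> f k = 0" and xy: "0 \<le> x" "x \<le> y"
  shows "(y - x) * f (nat \<lceil>y\<rceil> - 1) \<le> cumulative f N y - cumulative f N x"
proof -
  have nn: "f k \<ge> 0" for k
    using antimonoD[OF f(1), of k "max k N"] f(2)[of "max k N"] by simp
  show ?thesis
  proof (cases "y \<le> real N")
    case True
    have "(y - x) * f (nat \<lceil>y\<rceil> - 1) = (\<Sum>k<N. f (nat \<lceil>y\<rceil> - 1) * (overlap y k - overlap x k))"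
      using True xy by (simp add: sum_distrib_left[symmetric] sum_subtractf sum_overlap)
    also have "\<dots> \<le> (\<Sum>k<N. f k * (overlap y k - overlap x k))"
    proof (rule sum_mono)
      fix k assume "k \<in> {..<N}"
      show "f (nat \<lceil>y\<rceil> - 1) * (overlap y k - overlap x k) \<le> f k * (overlap y k - overlap x k)"
      proof (cases "real k < y")
        case True
        then have "k \<le> nat \<lceil>y\<rceil> - 1" by linarith
        then show ?thesis
          using antimonoD[OF f(1)] overlap_mono[OF xy(2)] by (intro mult_right_mono) auto
      next
        case False
        then have "overlap y k - overlap x k = 0"
          using xy by (auto simp: overlap_def)
        then show ?thesis by simp
      qed
    qed
    finally show ?thesis by (simp add: cumulative_diff)
  next
    case False
    then have "nat \<lceil>y\<rceil> - 1 \<ge> N" by linarith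
    then have "f (nat \<lceil>y\<rceil> - 1) = 0" by (rule f(2))
    moreover have "0 \<le> (\<Sum>k<N. f k * (overlap y k - overlap x k))"
      using nn overlap_mono[OF xy(2)] by (intro sum_nonneg mult_nonneg_nonneg) auto
    ultimately show ?thesis by (simp add: cumulative_diff)
  qed
qed

text \<open>Bridge between right and left limits of the step function, whose indices can differ only
  at integers.\<close>

lemma floor_ge_ceiling_minus_one: "nat \<lceil>x::real\<rceil> - 1 \<le> nat \<lfloor>x\<rfloor>"
  by linarith

text \<open>Cut the integral at the powers \<open>t ^ (i + 2)\<close>. The piece up to
  \<open>t\<^sup>2\<close> costs at most \<open>t\<^sup>2 * f 0\<close>; the piece starting at
  \<open>t ^ (i + 2)\<close> has length \<open>t\<^sup>2 * (t - 1) * t ^ i\<close>, which is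
  \<open>t\<^sup>2\<close> times the coefficient of sample \<open>i\<close>. As \<open>t ^ m\<close>
  is at least \<open>N\<close>, nothing is left over.\<close>

lemma sum_le_geometric_samples:
  fixes t :: real
  assumes f: "antimono f" "\<And>k. k \<ge> N \<Longrightarrow> f k = 0" and t: "t > 1" and N: "t ^ m \<ge> real N"
  shows "(\<Sum>k<N. f k)
    \<le> t\<^sup>2 * (f 0 + (t - 1) * (\<Sum>i<m. f (nat \<lceil>t ^ (i + 2)\<rceil> - 1) * t ^ i))"
proof -
  have nn: "f k \<ge> 0" for k
    using antimonoD[OF f(1), of k "max k N"] f(2)[of "max k N"] by simp
  let ?F = "cumulative f N"
  have "?F (t\<^sup>2) \<le> t\<^sup>2 * f 0"
    using cumulative_diff_le[of f 0 "t\<^sup>2" N] f nn by (simp add: cumulative_def overlap_def)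
  moreover have "?F (t ^ (m + 2)) - ?F (t\<^sup>2)
      = (\<Sum>i<m. ?F (t ^ (Suc i + 2)) - ?F (t ^ (i + 2)))"
    by (subst sum_lessThan_telescope) (simp add: power2_eq_square)
  moreover have "\<dots> \<le> (\<Sum>i<m. t\<^sup>2 * (t - 1) * (f (nat \<lceil>t ^ (i + 2)\<rceil> - 1) * t ^ i))"
  proof (rule sum_mono)
    fix i
    have "?F (t ^ (Suc i + 2)) - ?F (t ^ (i + 2))
        \<le> (t ^ (Suc i + 2) - t ^ (i + 2)) * f (nat \<lfloor>t ^ (i + 2)\<rfloor>)"
      using t by (intro cumulative_diff_le f nn power_increasing) auto
    also have "\<dots> \<le> (t ^ (Suc i + 2) - t ^ (i + 2)) * f (nat \<lceil>t ^ (i + 2)\<rceil> - 1)"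
      using t power_increasing[of "i + 2" "Suc i + 2" t]
      by (intro mult_left_mono antimonoD[OF f(1)] floor_ge_ceiling_minus_one) auto
    also have "\<dots> = t\<^sup>2 * (t - 1) * (f (nat \<lceil>t ^ (i + 2)\<rceil> - 1) * t ^ i)"
      by (simp add: power2_eq_square algebra_simps)
    finally show "?F (t ^ (Suc i + 2)) - ?F (t ^ (i + 2)) \<le> \<dots>" .
  qed
  moreover have "?F (t ^ (m + 2)) = (\<Sum>k<N. f k)"
    using N t power_increasing[of m "m + 2" t] by (intro cumulative_eq_sum) linarith
  ultimately show ?thesis by (simp add: sum_distrib_left algebra_simps)
qed

text \<open>Sample \<open>i + 2\<close> is taken at \<open>t ^ (i + 1)\<close>, the right end of
  \<open>[t ^ i, t ^ (i + 1)]\<close>, so its term is at most \<open>t\<^sup>2\<close> times the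
  integral over that interval. Samples \<open>0\<close> and \<open>1\<close> have no such interval;
  they are bounded by \<open>f 0\<close> and paid for by the integral over \<open>[0, 1]\<close>.
  Writing \<open>t ^ i / t\<close> keeps the exponent \<open>i - 1\<close> meaningful at
  \<open>i = 0\<close>.\<close>

lemma geometric_samples_le_sum:
  fixes t :: real
  assumes f: "antimono f" "\<And>k. k \<ge> N \<Longrightarrow> f k = 0" and t: "t > 1"
  shows "f 0 + (t - 1) * (\<Sum>i<m. f (nat \<lfloor>t ^ i / t\<rfloor>) * t ^ i) \<le> t\<^sup>2 * (\<Sum>k<N. f k)"
proof -
  have nn: "f k \<ge> 0" for k
    using antimonoD[OF f(1), of k "max k N"] f(2)[of "max k N"] by simp
  let ?F = "cumulative f N"
  let ?g = "\<lambda>i. f (nat \<lfloor>t ^ i / t\<rfloor>) * t ^ i"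
  have F1: "f 0 \<le> ?F 1"
    using cumulative_diff_ge[of f N 0 1] f by (simp add: cumulative_def overlap_def)
  \<comment> \<open>Two nonnegative terms are added so that exactly \<open>m\<close> shifted terms
    remain once the indices \<open>0\<close> and \<open>1\<close> are split off.\<close>
  have "(\<Sum>i<m. ?g i) \<le> (\<Sum>i<m + 2. ?g i)"
    using t nn by (intro sum_mono2) auto
  also have "\<dots> = ?g 0 + (?g 1 + (\<Sum>i<m. ?g (i + 2)))"
    by (simp only: add_2_eq_Suc' sum.lessThan_Suc_shift) (simp add: add.assoc)
  also have "\<dots> \<le> f 0 + (f 0 * t + (\<Sum>i<m. ?g (i + 2)))"
    using t antimonoD[OF f(1), of 0]
    by (intro add_mono mult_mono order.refl) (auto simp: nn intro!: mult_right_mono)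
  finally have "f 0 + (t - 1) * (\<Sum>i<m. ?g i)
      \<le> f 0 + (t - 1) * (f 0 + (f 0 * t + (\<Sum>i<m. ?g (i + 2))))"
    using t by simp
  \<comment> \<open>By \<open>1 + (t - 1) * (1 + t) = t\<^sup>2\<close> the leading term and the
    first two samples use up exactly the allowed factor.\<close>
  also have "\<dots> = t\<^sup>2 * f 0 + (t - 1) * (\<Sum>i<m. ?g (i + 2))"
    by (simp add: algebra_simps power2_eq_square)
  also have "(t - 1) * (\<Sum>i<m. ?g (i + 2)) \<le> (\<Sum>i<m. t\<^sup>2 * (?F (t ^ Suc i) - ?F (t ^ i)))"
    unfolding sum_distrib_left
  proof (rule sum_mono)
    fix i
    have eq: "t ^ (i + 2) / t = t ^ Suc i"
      using t by simp
    have "(t - 1) * ?g (i + 2) = t\<^sup>2 * ((t ^ Suc i - t ^ i) * f (nat \<lfloor>t ^ Suc i\<rfloor>))"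
      unfolding eq by (simp add: power2_eq_square algebra_simps)
    also have "\<dots> \<le> t\<^sup>2 * ((t ^ Suc i - t ^ i) * f (nat \<lceil>t ^ Suc i\<rceil> - 1))"
      using t power_increasing[of i "Suc i" t]
      by (intro mult_left_mono antimonoD[OF f(1)] floor_ge_ceiling_minus_one) auto
    also have "\<dots> \<le> t\<^sup>2 * (?F (t ^ Suc i) - ?F (t ^ i))"
      using t by (intro mult_left_mono cumulative_diff_ge f power_increasing) auto
    finally show "(t - 1) * ?g (i + 2) \<le> \<dots>" .
  qed
  also have "\<dots> = t\<^sup>2 * (?F (t ^ m) - ?F 1)"
    using sum_lessThan_telescope[of "\<lambda>i. ?F (t ^ i)" m] by (simp flip: sum_distrib_left)
  also have "t\<^sup>2 * f 0 + t\<^sup>2 * (?F (t ^ m) - ?F 1) \<le> t\<^sup>2 * ?F (t ^ m)"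
    using mult_left_mono[OF F1, of "t\<^sup>2"] by (simp add: algebra_simps)
  also have "\<dots> \<le> t\<^sup>2 * (\<Sum>k<N. f k)"
    by (intro mult_left_mono cumulative_le_sum nn) auto
  finally show ?thesis by simp
qed

section \<open>Random affine maps\<close>

text \<open>Comparing two fibres in both orders turns the inequality into equality, so all values
  carry the same mass. In an application one injection, built for an arbitrary ordered pair of
  values, is enough.\<close>

lemma map_pmf_of_set_equal_fibres:
  assumes "finite A" "A \<noteq> {}" "finite B" "f ` A \<subseteq> B"
    and fibres: "\<And>y y'. y \<in> B \<Longrightarrow> y' \<in> B \<Longrightarrow> card {x \<in> A. f x = y} \<le> card {x \<in> A. f x = y'}"
  shows "map_pmf f (pmf_of_set A) = pmf_of_set B"
proof (rule pmf_eqI)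
  fix y
  have B: "B \<noteq> {}" using assms by auto
  have pmf: "pmf (map_pmf f (pmf_of_set A)) y = card {x \<in> A. f x = y} / card A"
    using assms by (simp add: pmf_map measure_pmf_of_set vimage_def Int_def)
  show "pmf (map_pmf f (pmf_of_set A)) y = pmf (pmf_of_set B) y"
  proof (cases "y \<in> B")
    case True
    have "card A = (\<Sum>y'\<in>B. card {x \<in> A. f x = y'})"
      using assms sum_fun_comp[of A B f "\<lambda>_. 1::nat"] by simp
    also have "\<dots> = (\<Sum>y'\<in>B. card {x \<in> A. f x = y})"
      using True fibres by (intro sum.cong refl antisym) auto
    finally have "card A = card B * card {x \<in> A. f x = y}" by simp
    moreover have "card A > 0" using assms by (simp add: card_gt_0_iff)
    ultimately show ?thesis
      unfolding pmf using True assms(3) B by (simp add: field_simps)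
  next
    case False
    then have "{x \<in> A. f x = y} = {}" using assms(4) by auto
    then show ?thesis unfolding pmf \<open>{x \<in> A. f x = y} = {}\<close> using False assms(3) B by simp
  qed
qed

lemma pair_pmf_of_set:
  assumes "finite A" "A \<noteq> {}" "finite B" "B \<noteq> {}"
  shows "pair_pmf (pmf_of_set A) (pmf_of_set B) = pmf_of_set (A \<times> B)"
proof (rule pmf_eqI)
  fix x
  show "pmf (pair_pmf (pmf_of_set A) (pmf_of_set B)) x = pmf (pmf_of_set (A \<times> B)) x"
    using assms by (cases x) (simp add: pmf_pair indicator_def)
qed

text \<open>With \<open>R = UNIV\<close> the domain is the support of the \<open>Pi_pmf\<close>
  behind \<open>random_vec\<close>, which makes random vectors uniform; a smaller \<open>R\<close>
  serves to count the vectors accepted by the threshold.\<close>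

lemma bij_betw_vec: "bij_betw (Matrix.vec m) (PiE_dflt {..<m} d (\<lambda>_. R)) {v \<in> carrier_vec m. \<forall>j<m. v $ j \<in> R}"
proof (rule bij_betw_byWitness[where f' = "\<lambda>v j. if j < m then v $ j else d"])
qed (auto simp: PiE_dflt_def fun_eq_iff)

lemma bij_betw_mat: "bij_betw (Matrix.mat m n) (PiE_dflt ({..<m} \<times> {..<n}) d (\<lambda>_. UNIV)) (carrier_mat m n)"
proof (rule bij_betw_byWitness[where f' = "\<lambda>A (i, j). if i < m \<and> j < n then A $$ (i, j) else d"])
qed (auto simp: PiE_dflt_def fun_eq_iff)

lemma card_vec_restrict:
  fixes R :: "'a::finite set"
  shows "card {v \<in> carrier_vec m. \<forall>j<m. v $ j \<in> R} = card R ^ m"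
  using bij_betw_same_card[OF bij_betw_vec[of m undefined R]] by (simp add: card_PiE_dflt)

lemma card_carrier_vec: "card (carrier_vec m :: 'a::finite vec set) = CARD('a) ^ m"
  using card_vec_restrict[of m "UNIV :: 'a set"] by simp

lemma finite_carrier_vec [simp]: "finite (carrier_vec m :: 'a::finite vec set)"
  using bij_betw_finite[OF bij_betw_vec[of m undefined "UNIV :: 'a set"]]
  by (simp add: finite_PiE_dflt)

lemma finite_carrier_mat [simp]: "finite (carrier_mat m n :: 'a::finite mat set)"
  using bij_betw_finite[OF bij_betw_mat[of m n "undefined :: 'a"]]
  by (simp add: finite_PiE_dflt)

lemma carrier_vec_nonempty [simp]: "carrier_vec m \<noteq> {}"
  using vec_carrier[of m undefined] by blast

lemma carrier_mat_nonempty [simp]: "carrier_mat m n \<noteq> {}"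
  using mat_carrier[of m n undefined] by blast

lemma random_vec_uniform: "random_vec m = (pmf_of_set (carrier_vec m) :: 'a::{field,finite} vec pmf)"
  unfolding random_vec_def using bij_betw_vec[of m "0::'a" UNIV]
  by (subst Pi_pmf_of_set, simp, simp, simp, subst map_pmf_of_set_bij_betw)
     (auto simp: finite_PiE_dflt)

lemma random_mat_uniform: "random_mat m n = (pmf_of_set (carrier_mat m n) :: 'a::{field,finite} mat pmf)"
  unfolding random_mat_def using bij_betw_mat[of m n "0::'a"]
  by (subst Pi_pmf_of_set, simp, simp, simp, subst map_pmf_of_set_bij_betw)
     (auto simp: finite_PiE_dflt)

text \<open>A single coordinate \<open>j\<close> in which the two vectors differ suffices: row
  \<open>i\<close> is the line through \<open>(\<sigma> $ j, u $ i)\<close> and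
  \<open>(\<tau> $ j, v $ i)\<close>, with slope \<open>c i\<close> and intercept
  \<open>d $ i\<close>.\<close>

lemma affine_interpolation:
  fixes \<sigma> \<tau> :: "'a::field vec"
  assumes "\<sigma> \<in> carrier_vec n" "\<tau> \<in> carrier_vec n" "\<sigma> \<noteq> \<tau>" "u \<in> carrier_vec m" "v \<in> carrier_vec m"
  obtains C d where "C \<in> carrier_mat m n" "d \<in> carrier_vec m" "C *\<^sub>v \<sigma> + d = u" "C *\<^sub>v \<tau> + d = v"
proof -
  obtain j where j: "j < n" "\<sigma> $ j \<noteq> \<tau> $ j"
    using assms(1-3) by (metis carrier_vecD eq_vecI)
  define c where "c i = (u $ i - v $ i) / (\<sigma> $ j - \<tau> $ j)" for i
  define C where "C = Matrix.mat m n (\<lambda>(i, k). if k = j then c i else 0)"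
  define d where "d = Matrix.vec m (\<lambda>i. u $ i - c i * \<sigma> $ j)"
  have C: "(C *\<^sub>v x) $ i = c i * x $ j" if "i < m" "x \<in> carrier_vec n" for i x
  proof -
    have "(C *\<^sub>v x) $ i = (\<Sum>k\<in>{0..<n}. if k = j then c i * x $ j else 0)"
      using that j unfolding C_def
      by (auto simp: scalar_prod_def mult_delta_left simp del: sum.delta intro!: sum.cong)
    then show ?thesis using j by simp
  qed
  have "C *\<^sub>v \<sigma> + d = u"
    using assms C by (intro eq_vecI) (auto simp: d_def)
  moreover have "C *\<^sub>v \<tau> + d = v"
  proof (intro eq_vecI)
    fix i assume "i < dim_vec v"
    then have i: "i < m" using assms by simp
    have "(C *\<^sub>v \<tau> + d) $ i = u $ i - c i * (\<sigma> $ j - \<tau> $ j)"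
      using i assms C by (simp add: d_def algebra_simps)
    then show "(C *\<^sub>v \<tau> + d) $ i = v $ i" using j by (simp add: c_def)
  qed (use assms in \<open>auto simp: d_def\<close>)
  ultimately show thesis
    by (intro that[of C d]) (auto simp: C_def d_def)
qed

text \<open>
  Adding an interpolating affine map to \<open>(A, b)\<close> carries the fibre over any pair of values into the
  fibre over any other pair.
\<close>

lemma random_affine_pair:
  fixes \<sigma> \<tau> :: "'a::{field,finite} vec"
  assumes st: "\<sigma> \<in> carrier_vec n" "\<tau> \<in> carrier_vec n" "\<sigma> \<noteq> \<tau>"
  shows "map_pmf (\<lambda>(A, b). (A *\<^sub>v \<sigma> + b, A *\<^sub>v \<tau> + b)) (pair_pmf (random_mat m n) (random_vec m))
         = pmf_of_set (carrier_vec m \<times> carrier_vec m)"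
proof -
  let ?f = "\<lambda>(A, b). (A *\<^sub>v \<sigma> + b, A *\<^sub>v \<tau> + b)"
  let ?D = "carrier_mat m n \<times> carrier_vec m :: ('a mat \<times> 'a vec) set"
  have "map_pmf ?f (pmf_of_set ?D) = pmf_of_set (carrier_vec m \<times> carrier_vec m)"
  proof (rule map_pmf_of_set_equal_fibres)
    fix y y' :: "'a vec \<times> 'a vec"
    assume y: "y \<in> carrier_vec m \<times> carrier_vec m" "y' \<in> carrier_vec m \<times> carrier_vec m"
    then have "fst y' - fst y \<in> carrier_vec m" "snd y' - snd y \<in> carrier_vec m" by auto
    then obtain C d where C: "C \<in> carrier_mat m n" "d \<in> carrier_vec m"
      and eq: "C *\<^sub>v \<sigma> + d = fst y' - fst y" "C *\<^sub>v \<tau> + d = snd y' - snd y"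
      using affine_interpolation[OF st] by metis
    let ?g = "\<lambda>(A, b). (A + C, b + d)"
    have move: "(A + C) *\<^sub>v x + (b + d) = (A *\<^sub>v x + b) + (C *\<^sub>v x + d)"
      if "A \<in> carrier_mat m n" "b \<in> carrier_vec m" "x \<in> carrier_vec n" for A b x
      using that C by (subst add_mult_distrib_mat_vec[of _ m n]) (auto intro!: eq_vecI)
    have cancel: "z + (z' - z) = z'" if "z \<in> carrier_vec m" "z' \<in> carrier_vec m" for z z' :: "'a vec"
      using that by (intro eq_vecI) auto
    show "card {x \<in> ?D. ?f x = y} \<le> card {x \<in> ?D. ?f x = y'}"
    proof (rule card_inj_on_le[of ?g])
      show "inj_on ?g {x \<in> ?D. ?f x = y}"
      proof (rule inj_onI, clarify)
        fix A b A' b'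
        assume c: "A \<in> carrier_mat m n" "b \<in> carrier_vec m" "A' \<in> carrier_mat m n" "b' \<in> carrier_vec m"
          and e: "A + C = A' + C" "b + d = b' + d"
        have "A = A'"
        proof (rule eq_matI)
          fix i j assume "i < dim_row A'" "j < dim_col A'"
          then show "A $$ (i, j) = A' $$ (i, j)"
            using arg_cong[OF e(1), of "\<lambda>M. M $$ (i, j)"] c C by auto
        qed (use c in auto)
        moreover have "b = b'"
        proof (rule eq_vecI)
          fix i assume "i < dim_vec b'"
          then show "b $ i = b' $ i"
            using arg_cong[OF e(2), of "\<lambda>v. v $ i"] c C by auto
        qed (use c in auto)
        ultimately show "A = A' \<and> b = b'" ..
      qed
      show "?g ` {x \<in> ?D. ?f x = y} \<subseteq> {x \<in> ?D. ?f x = y'}"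
        using st C y by (auto simp: move eq cancel)
      show "finite {x \<in> ?D. ?f x = y'}"
        by (rule finite_subset[of _ ?D]) auto
    qed
  qed (use st in auto)
  then show ?thesis
    by (simp add: random_mat_uniform random_vec_uniform pair_pmf_of_set)
qed

section \<open>Second moment, majority and median\<close>

text \<open>One-sided Chebyshev argument: the number \<open>X\<close> of events that occur has mean
  \<open>\<mu>\<close> and second moment at most \<open>\<mu> + \<mu>\<^sup>2\<close>, and
  \<open>(1 - c * X)\<^sup>2\<close> dominates the indicator of no event. The choice
  \<open>c = 1 / (1 + \<mu>)\<close> minimises the resulting bound; plain Chebyshev would only give
  \<open>1 / \<mu>\<close>.\<close>

lemma second_moment_none:
  fixes M :: "'a pmf"
  assumes "finite T" "p \<ge> 0"
    and one: "\<And>x. x \<in> T \<Longrightarrow> measure_pmf.prob M {\<omega>. P x \<omega>} = p"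
    and two: "\<And>x y. x \<in> T \<Longrightarrow> y \<in> T \<Longrightarrow> x \<noteq> y \<Longrightarrow> measure_pmf.prob M {\<omega>. P x \<omega> \<and> P y \<omega>} = p\<^sup>2"
  shows "measure_pmf.prob M {\<omega>. \<forall>x\<in>T. \<not> P x \<omega>} \<le> 1 / (1 + real (card T) * p)"
proof -
  define \<mu> where "\<mu> = real (card T) * p"
  have \<mu>: "\<mu> \<ge> 0" using assms by (simp add: \<mu>_def)
  let ?I = "\<lambda>x. indicator {\<omega>. P x \<omega>} :: 'a \<Rightarrow> real"
  define X where "X \<omega> = (\<Sum>x\<in>T. ?I x \<omega>)" for \<omega>
  have X2: "(X \<omega>)\<^sup>2 = (\<Sum>x\<in>T. \<Sum>y\<in>T. indicator {\<omega>. P x \<omega> \<and> P y \<omega>} \<omega>)" for \<omega>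
    by (auto simp: X_def power2_eq_square sum_product indicator_def intro!: sum.cong)
  have int0: "integrable M (indicator A :: 'a \<Rightarrow> real)" for A
    by (simp add: measure_pmf.emeasure_eq_measure)
  have int1: "integrable M X"
    unfolding X_def by (intro Bochner_Integration.integrable_sum int0)
  have int2: "integrable M (\<lambda>\<omega>. (X \<omega>)\<^sup>2)"
    unfolding X2 by (intro Bochner_Integration.integrable_sum int0)
  have EX: "measure_pmf.expectation M X = \<mu>"
    unfolding X_def by (subst Bochner_Integration.integral_sum) (auto simp: one \<mu>_def int0)
  have "measure_pmf.expectation M (\<lambda>\<omega>. (X \<omega>)\<^sup>2)
      = (\<Sum>x\<in>T. \<Sum>y\<in>T. measure_pmf.prob M {\<omega>. P x \<omega> \<and> P y \<omega>})"
    unfolding X2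
    by (subst Bochner_Integration.integral_sum; (intro Bochner_Integration.integrable_sum int0)?)+
       simp
  \<comment> \<open>The diagonal is counted as \<open>p + p\<^sup>2\<close> instead of
    \<open>p\<close>, for the sake of a closed form.\<close>
  also have "\<dots> \<le> (\<Sum>x\<in>T. \<Sum>y\<in>T. (if y = x then p else 0) + p\<^sup>2)"
    using assms(2) by (intro sum_mono) (auto simp: one two)
  also have "\<dots> = \<mu> + \<mu>\<^sup>2"
    using assms(1) by (simp add: sum.distrib \<mu>_def power2_eq_square algebra_simps)
  finally have EX2: "measure_pmf.expectation M (\<lambda>\<omega>. (X \<omega>)\<^sup>2) \<le> \<mu> + \<mu>\<^sup>2" .
  txt \<open>On the event that nothing occurs, \<open>X = 0\<close> and so \<open>(1 - X / (1 + \<mu>))\<^sup>2 = 1\<close>.\<close>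
  have "measure_pmf.prob M {\<omega>. \<forall>x\<in>T. \<not> P x \<omega>}
      = measure_pmf.expectation M (indicator {\<omega>. \<forall>x\<in>T. \<not> P x \<omega>})"
    by simp
  also have "\<dots> \<le> measure_pmf.expectation M (\<lambda>\<omega>. 1 - 2 / (1 + \<mu>) * X \<omega> + 1 / (1 + \<mu>)\<^sup>2 * (X \<omega>)\<^sup>2)"
  proof (rule integral_mono)
    fix \<omega>
    have "X \<omega> = 0" if "\<forall>x\<in>T. \<not> P x \<omega>" using that by (simp add: X_def)
    moreover have "1 - 2 / (1 + \<mu>) * X \<omega> + 1 / (1 + \<mu>)\<^sup>2 * (X \<omega>)\<^sup>2 = (1 - X \<omega> / (1 + \<mu>))\<^sup>2"
      by (simp add: power2_diff power_divide)
    ultimately show "indicator {\<omega>. \<forall>x\<in>T. \<not> P x \<omega>} \<omega>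
        \<le> 1 - 2 / (1 + \<mu>) * X \<omega> + 1 / (1 + \<mu>)\<^sup>2 * (X \<omega>)\<^sup>2"
      by (auto simp: indicator_def)
  qed (use int0 int1 int2 in \<open>auto intro!: Bochner_Integration.integrable_add Bochner_Integration.integrable_diff\<close>)
  also have "\<dots> = 1 - 2 / (1 + \<mu>) * \<mu> + 1 / (1 + \<mu>)\<^sup>2 * measure_pmf.expectation M (\<lambda>\<omega>. (X \<omega>)\<^sup>2)"
    using int1 int2 EX by simp
  also have "\<dots> \<le> 1 - 2 / (1 + \<mu>) * \<mu> + 1 / (1 + \<mu>)\<^sup>2 * (\<mu> + \<mu>\<^sup>2)"
    using EX2 by (intro add_left_mono mult_left_mono) auto
  also have "\<mu> + \<mu>\<^sup>2 = \<mu> * (1 + \<mu>)"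
    by (simp add: algebra_simps power2_eq_square)
  also have "1 / (1 + \<mu>)\<^sup>2 * (\<mu> * (1 + \<mu>)) = \<mu> / (1 + \<mu>)"
    unfolding power2_eq_square by simp
  also have "1 - 2 / (1 + \<mu>) * \<mu> + \<mu> / (1 + \<mu>) = 1 / (1 + \<mu>)"
    using \<mu> by (simp add: divide_simps)
  finally show ?thesis by (simp add: \<mu>_def)
qed

text \<open>Chernoff bound: each hit multiplies the weight by \<open>t\<close>, so one trial has
  mean weight at most \<open>2 * t / (1 + t)\<close>, while a majority of hits forces weight at
  least \<open>sqrt t ^ k\<close>. For hit probability \<open>1 / (1 + t)\<close> the base
  \<open>t\<close> is the optimal one.\<close>

lemma replicate_pmf_majority:
  fixes t :: real
  assumes t: "t > 1" and p: "measure_pmf.prob M {x. P x} \<le> 1 / (1 + t)"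
  shows "measure_pmf.prob (replicate_pmf k M) {xs. 2 * length (filter P xs) \<ge> k}
         \<le> (2 * sqrt t / (1 + t)) ^ k"
proof -
  have step: "(\<integral>\<^sup>+x. ennreal (if P x then t else 1) \<partial>M) \<le> ennreal (2 * t / (1 + t))"
  proof -
    have "(\<integral>\<^sup>+x. ennreal (if P x then t else 1) \<partial>M)
        = (\<integral>\<^sup>+x. 1 + ennreal (t - 1) * indicator {x. P x} x \<partial>M)"
      using t ennreal_plus[of 1 "t - 1"] by (intro nn_integral_cong) (auto simp: indicator_def)
    also have "\<dots> = 1 + ennreal (t - 1) * emeasure M {x. P x}"
      by (subst nn_integral_add) (auto simp: nn_integral_cmult)
    also have "\<dots> = ennreal (1 + (t - 1) * measure_pmf.prob M {x. P x})"
      using t by (simp add: measure_pmf.emeasure_eq_measure ennreal_mult[symmetric] flip: ennreal_1)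
    also have "\<dots> \<le> ennreal (1 + (t - 1) * (1 / (1 + t)))"
      using t p by (intro ennreal_leI add_left_mono mult_left_mono) auto
    also have "1 + (t - 1) * (1 / (1 + t)) = 2 * t / (1 + t)"
      using t by (simp add: field_simps)
    finally show ?thesis .
  qed
  have mgf: "(\<integral>\<^sup>+xs. ennreal (t ^ length (filter P xs)) \<partial>replicate_pmf k M) \<le> ennreal ((2 * t / (1 + t)) ^ k)"
  proof (induction k)
    case (Suc k)
    have "(\<integral>\<^sup>+xs. ennreal (t ^ length (filter P xs)) \<partial>replicate_pmf (Suc k) M)
        = (\<integral>\<^sup>+x. \<integral>\<^sup>+xs. ennreal (if P x then t else 1) * ennreal (t ^ length (filter P xs))
             \<partial>replicate_pmf k M \<partial>M)"
      using t by (auto simp: ennreal_mult[symmetric] intro!: nn_integral_cong)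
    also have "\<dots> = (\<integral>\<^sup>+x. ennreal (if P x then t else 1) \<partial>M)
        * (\<integral>\<^sup>+xs. ennreal (t ^ length (filter P xs)) \<partial>replicate_pmf k M)"
      by (simp add: nn_integral_cmult nn_integral_multc)
    also have "\<dots> \<le> ennreal (2 * t / (1 + t)) * ennreal ((2 * t / (1 + t)) ^ k)"
      by (intro mult_mono step Suc) auto
    also have "\<dots> = ennreal ((2 * t / (1 + t)) ^ Suc k)"
      using t by (simp add: ennreal_mult[symmetric])
    finally show ?case .
  qed (use t in simp)
  \<comment> \<open>Markov's inequality at the threshold \<open>sqrt t ^ k\<close>.\<close>
  have "ennreal (sqrt t ^ k) * emeasure (replicate_pmf k M) {xs. 2 * length (filter P xs) \<ge> k}
      = (\<integral>\<^sup>+xs. ennreal (sqrt t ^ k) * indicator {xs. 2 * length (filter P xs) \<ge> k} xs \<partial>replicate_pmf k M)"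
    by (simp add: nn_integral_cmult)
  also have "\<dots> \<le> (\<integral>\<^sup>+xs. ennreal (t ^ length (filter P xs)) \<partial>replicate_pmf k M)"
  proof (rule nn_integral_mono)
    fix xs
    have "sqrt t ^ k \<le> t ^ length (filter P xs)" if "2 * length (filter P xs) \<ge> k"
    proof -
      have "sqrt t ^ k \<le> sqrt t ^ (2 * length (filter P xs))"
        using that t by (intro power_increasing) auto
      also have "\<dots> = t ^ length (filter P xs)" using t by (simp add: power_mult)
      finally show ?thesis .
    qed
    then show "ennreal (sqrt t ^ k) * indicator {xs. 2 * length (filter P xs) \<ge> k} xs
        \<le> ennreal (t ^ length (filter P xs))"
      by (auto simp: indicator_def intro!: ennreal_leI)
  qed
  also note mgf
  finally have "sqrt t ^ k * measure_pmf.prob (replicate_pmf k M) {xs. 2 * length (filter P xs) \<ge> k}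
      \<le> (2 * t / (1 + t)) ^ k"
    using t by (simp add: measure_pmf.emeasure_eq_measure ennreal_mult[symmetric])
  also have "\<dots> = sqrt t ^ k * (2 * sqrt t / (1 + t)) ^ k"
    using t by (simp add: power_mult_distrib[symmetric] mult.left_commute[of "sqrt t"])
  finally show ?thesis using t by simp
qed

text \<open>The median is at most the upper middle entry, so that entry and all later ones of the
  sorted list exceed \<open>B\<close>; they make up at least half of the list.\<close>

lemma median_gt_imp:
  assumes "xs \<noteq> []" "median xs > B"
  shows "2 * length (filter (\<lambda>x. x > B) xs) \<ge> length xs"
proof -
  let ?k = "length xs" and ?ys = "sort xs"
  let ?h = "?k div 2"
  have h: "?h < ?k" using assms by (cases xs) auto
  have "?ys ! ((?k - 1) div 2) \<le> ?ys ! ?h"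
    using h by (intro sorted_nth_mono) auto
  then have "?ys ! ?h > B" using assms(2) by (simp add: median_def Let_def)
  moreover have "?ys ! ?h \<le> x" if "x \<in> set (drop ?h ?ys)" for x
    using that sorted_nth_mono[OF sorted_sort, of ?h "?h + _" xs]
    by (auto simp: in_set_conv_nth)
  ultimately have "\<forall>x\<in>set (drop ?h ?ys). x > B" by force
  then have "filter (\<lambda>x. x > B) (drop ?h ?ys) = drop ?h ?ys" by simp
  then have "?k - ?h \<le> length (filter (\<lambda>x. x > B) ?ys)"
    by (metis append_take_drop_id filter_append le_add2 length_append length_drop length_sort)
  also have "\<dots> = length (filter (\<lambda>x. x > B) xs)"
    by (metis mset_filter mset_sort size_mset)
  finally show ?thesis by linarith
qed

text \<open>Mirror image, with the lower middle entry and the initial segment that ends in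
  it.\<close>

lemma median_lt_imp:
  assumes "xs \<noteq> []" "median xs < B"
  shows "2 * length (filter (\<lambda>x. x < B) xs) \<ge> length xs"
proof -
  let ?k = "length xs" and ?ys = "sort xs"
  let ?h = "(?k - 1) div 2"
  have h: "?k div 2 < ?k" using assms by (cases xs) auto
  have "?ys ! ?h \<le> ?ys ! (?k div 2)"
    using h by (intro sorted_nth_mono) auto
  then have "?ys ! ?h < B" using assms(2) by (simp add: median_def Let_def)
  moreover have "x \<le> ?ys ! ?h" if "x \<in> set (take (Suc ?h) ?ys)" for x
    using that sorted_nth_mono[OF sorted_sort, of _ ?h xs] h
    by (auto simp: in_set_conv_nth)
  ultimately have "\<forall>x\<in>set (take (Suc ?h) ?ys). x < B" by force
  then have "filter (\<lambda>x. x < B) (take (Suc ?h) ?ys) = take (Suc ?h) ?ys" by simp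
  then have "length (take (Suc ?h) ?ys) \<le> length (filter (\<lambda>x. x < B) ?ys)"
    by (metis append_take_drop_id filter_append le_add1 length_append)
  then have "Suc ?h \<le> length (filter (\<lambda>x. x < B) ?ys)"
    using h by simp
  also have "\<dots> = length (filter (\<lambda>x. x < B) xs)"
    by (metis mset_filter mset_sort size_mset)
  finally show ?thesis by linarith
qed

section \<open>Parameters of the algorithm\<close>

text \<open>Here \<open>r = (q - 1) div 2\<close>, so \<open>q\<close> is \<open>2 * r + 1\<close>
  or \<open>2 * r + 2\<close>. The strict bound \<open>2\<close> on the ratio is what puts the
  failure probabilities below \<open>1/3\<close>.\<close>

lemma wish_ratio_bounds:
  assumes "q \<ge> 3" "r = nat \<lfloor>(real q - 1) / 2\<rfloor>"
  shows "r \<ge> 1" "r < q" "2 * r \<le> q - 1" "q \<le> 2 * r + 2" "real q / real r > 2"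
proof -
  have "r = (q - 1) div 2"
  proof -
    have "(real q - 1) / 2 = real (q - 1) / real 2" using assms(1) by simp
    then show ?thesis using assms(2) by (simp only: floor_divide_of_nat_eq nat_int)
  qed
  then show "r \<ge> 1" "r < q" "2 * r \<le> q - 1" "q \<le> 2 * r + 2" using assms(1) by linarith+
  then show "real q / real r > 2" using assms(1) by (simp add: field_simps)
qed

text \<open>
  The repetition count is calibrated to a failure probability \<open>\<delta> / (2n)\<close> per level, which does
  not cover all \<open>n'\<close> levels. The events used here concentrate at a rate that exceeds
  \<open>\<gamma>\<close> by a factor \<open>m\<close>, and this makes up for the number of levels.
\<close>

lemma wish_gamma_margin:
  assumes "q \<ge> 3" "r = nat \<lfloor>(real q - 1) / 2\<rfloor>"
  defines "t \<equiv> real q / real r"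
  obtains m :: nat where "m \<ge> 1" "real m * wish_gamma q r \<le> ((t - 1) / (t + 1))\<^sup>2 / 2"
    "real q \<le> t ^ (2 ^ (m - 1))"
proof (cases "q \<ge> 7")
  case True
  note r = wish_ratio_bounds[OF assms(1,2)]
  have t2: "t > 2" using r(5) by (simp add: t_def)
  define m where "m = q div 2"
  have m: "m \<ge> 3" "q \<le> 2 * m + 1" "2 * m \<le> q" using True by (auto simp: m_def)
  have "r \<ge> 3" using r(4) True by linarith
  have "1 / 2 - real r / real q \<le> 1 / real q" "1 / 2 - real r / real q \<ge> 0"
    using r(3,4) True by (auto simp: divide_simps)
  then have "(1 / 2 - real r / real q)\<^sup>2 \<le> (1 / real q)\<^sup>2"
    by (intro power_mono)
  then have "real m * wish_gamma q r \<le> real q / 2 * (real q / (3 * real r) * (1 / real q)\<^sup>2)"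
    unfolding wish_gamma_def using m by (intro mult_mono mult_left_mono mult_nonneg_nonneg) auto
  also have "\<dots> = 1 / (6 * real r)"
    using True r(1) by (simp add: field_simps power2_eq_square)
  also have "\<dots> \<le> (1 / 3)\<^sup>2 / 2"
    using \<open>r \<ge> 3\<close> by (simp add: field_simps power2_eq_square)
  also have "\<dots> \<le> ((t - 1) / (t + 1))\<^sup>2 / 2"
    using t2 by (intro divide_right_mono power_mono) (auto simp: field_simps)
  finally have 1: "real m * wish_gamma q r \<le> ((t - 1) / (t + 1))\<^sup>2 / 2" .
  have pow: "2 * k + 1 \<le> 2 ^ k" if "k \<ge> 3" for k :: nat
    using that by (induction k rule: dec_induct) auto
  have "m \<le> 2 ^ (m - 1)" using less_exp[of "m - 1"] m(1) by linarith
  then have "(2::nat) ^ m \<le> 2 ^ (2 ^ (m - 1))" by (intro power_increasing) auto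
  then have "q \<le> 2 ^ (2 ^ (m - 1))" using pow[OF m(1)] m(2) by linarith
  then have "real q \<le> real (2 ^ (2 ^ (m - 1)))" by (simp only: of_nat_le_iff)
  also have "\<dots> = 2 ^ (2 ^ (m - 1))" by simp
  also have "\<dots> \<le> t ^ (2 ^ (m - 1))" using t2 by (intro power_mono) auto
  finally show thesis using that[of m] 1 m by simp
next
  case False
  \<comment> \<open>The small cases are checked numerically with \<open>m = 2\<close>, where the
    last bound reads \<open>q \<le> t\<^sup>2\<close>.\<close>
  then have "q = 3 \<or> q = 4 \<or> q = 5 \<or> q = 6" using assms(1) by linarith
  then have "(q = 3 \<and> r = 1) \<or> (q = 4 \<and> r = 1) \<or> (q = 5 \<and> r = 2) \<or> (q = 6 \<and> r = 2)"
    using wish_ratio_bounds(3,4)[OF assms(1,2)] by linarith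
  then show thesis
    by (intro that[of 2]; elim disjE; simp add: wish_gamma_def t_def power2_eq_square)
qed

lemma wish_gamma_pos:
  assumes "q \<ge> 3" "r = nat \<lfloor>(real q - 1) / 2\<rfloor>"
  shows "wish_gamma q r > 0"
proof -
  note r = wish_ratio_bounds[OF assms]
  have "real r / real q < 1 / 2" using r(1,3) assms(1) by (simp add: field_simps)
  then show ?thesis using r(1) assms(1) by (simp add: wish_gamma_def)
qed

text \<open>With \<open>x = (t - 1) / (t + 1)\<close> the square of the left side is
  \<open>1 - x\<^sup>2\<close>, and \<open>1 + y \<le> exp y\<close> applies.\<close>

lemma chernoff_factor_le:
  fixes t :: real
  assumes "t > 1"
  shows "2 * sqrt t / (1 + t) \<le> exp (- ((t - 1) / (t + 1))\<^sup>2 / 2)"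
proof (rule power2_le_imp_le)
  have "(2 * sqrt t / (1 + t))\<^sup>2 = 4 * t / (1 + t)\<^sup>2"
    using assms by (simp add: power_divide power_mult_distrib)
  also have "\<dots> = 1 + - ((t - 1) / (t + 1))\<^sup>2"
    using assms by (simp add: divide_simps) (simp add: algebra_simps power2_eq_square)
  also have "\<dots> \<le> exp (- ((t - 1) / (t + 1))\<^sup>2)"
    by (rule exp_ge_add_one_self)
  also have "\<dots> = (exp (- ((t - 1) / (t + 1))\<^sup>2 / 2))\<^sup>2"
    by (simp flip: exp_double)
  finally show "(2 * sqrt t / (1 + t))\<^sup>2 \<le> (exp (- ((t - 1) / (t + 1))\<^sup>2 / 2))\<^sup>2" .
qed simp

text \<open>The levels reach the number \<open>q ^ n\<close> of all vectors, as
  \<open>sum_le_geometric_samples\<close> requires.\<close>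

lemma wish_levels_power_ge:
  assumes "q \<ge> 3" "r = nat \<lfloor>(real q - 1) / 2\<rfloor>"
  shows "real (q ^ n) \<le> (real q / real r) ^ wish_levels q r n"
proof -
  let ?t = "real q / real r"
  have t: "?t > 2" by (rule wish_ratio_bounds[OF assms])
  have cancel: "?t powr log ?t (real q) = real q"
    using t assms(1) by (intro powr_log_cancel) auto
  have "real (q ^ n) = real q powr real n"
    using assms(1) by (simp add: powr_realpow)
  also have "\<dots> = ?t powr (real n * log ?t (real q))"
    using cancel by (simp add: mult.commute[of "real n"] powr_powr[symmetric])
  also have "\<dots> \<le> ?t powr real (wish_levels q r n)"
    using t unfolding wish_levels_def by (intro powr_mono real_nat_ceiling_ge) auto
  also have "\<dots> = ?t ^ wish_levels q r n" using t by (simp add: powr_realpow)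
  finally show ?thesis .
qed

text \<open>With \<open>m\<close> from \<open>wish_gamma_margin\<close>, a level fails with
  probability at most \<open>2 * (\<delta> / (2 * n)) ^ m\<close>, and there are at most
  \<open>n * 2 ^ (m - 1)\<close> levels. The product is
  \<open>\<delta> * (\<delta> / n) ^ (m - 1)\<close>, where
  \<open>\<delta> < 1 \<le> n\<close>.\<close>

lemma wish_union_bound:
  assumes q: "q \<ge> 3" "r = nat \<lfloor>(real q - 1) / 2\<rfloor>" and n: "n \<ge> 1" and \<delta>: "0 < \<delta>" "\<delta> < 1"
  defines "t \<equiv> real q / real r"
  shows "real (wish_levels q r n) * (2 * (2 * sqrt t / (1 + t)) ^ wish_reps q r n \<delta>) \<le> \<delta>"
proof -
  have t: "t > 2" unfolding t_def by (rule wish_ratio_bounds[OF q])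
  obtain m where m: "m \<ge> 1" "real m * wish_gamma q r \<le> ((t - 1) / (t + 1))\<^sup>2 / 2"
    "real q \<le> t ^ (2 ^ (m - 1))"
    using wish_gamma_margin[OF q] unfolding t_def by blast
  let ?l = "wish_reps q r n \<delta>" and ?\<gamma> = "wish_gamma q r"
  have \<gamma>: "?\<gamma> > 0" by (rule wish_gamma_pos[OF q])
  have "log t (real q) \<le> 2 ^ (m - 1)"
  proof -
    have "log t (real q) \<le> log t (t ^ (2 ^ (m - 1)))"
      using m(3) t q(1) by (intro log_mono) auto
    then show ?thesis using t by (simp add: log_nat_power)
  qed
  then have "real n * log t (real q) \<le> of_int (int (n * 2 ^ (m - 1)))"
    using n by simp
  then have "wish_levels q r n \<le> n * 2 ^ (m - 1)"
    unfolding wish_levels_def t_def[symmetric] by (simp only: nat_le_iff ceiling_le_iff)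
  then have "real (wish_levels q r n) \<le> real (n * 2 ^ (m - 1))"
    by (simp only: of_nat_le_iff)
  then have levels: "real (wish_levels q r n) \<le> real n * 2 ^ (m - 1)" by simp
  have L: "ln (2 * real n / \<delta>) \<le> ?\<gamma> * real ?l"
  proof -
    have "1 / ?\<gamma> * ln (2 * real n / \<delta>) \<le> real ?l"
      unfolding wish_reps_def by (rule real_nat_ceiling_ge)
    then show ?thesis using \<gamma> by (simp add: field_simps)
  qed
  have "(2 * sqrt t / (1 + t)) ^ ?l \<le> exp (- ((t - 1) / (t + 1))\<^sup>2 / 2) ^ ?l"
    using t by (intro power_mono chernoff_factor_le) auto
  also have "\<dots> = exp (- (((t - 1) / (t + 1))\<^sup>2 / 2 * real ?l))"
    by (simp add: mult.commute flip: exp_of_nat_mult)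
  also have "\<dots> \<le> exp (- (real m * ?\<gamma> * real ?l))"
    using mult_right_mono[OF m(2), of "real ?l"] by simp
  also have "\<dots> \<le> exp (- (real m * ln (2 * real n / \<delta>)))"
    using mult_left_mono[OF L, of "real m"] by (simp add: mult.assoc)
  also have "\<dots> = exp (- ln (2 * real n / \<delta>)) ^ m"
    by (simp flip: exp_of_nat_mult)
  also have "exp (- ln (2 * real n / \<delta>)) = \<delta> / (2 * real n)"
    using n \<delta> by (simp add: exp_minus)
  finally have "real (wish_levels q r n) * (2 * (2 * sqrt t / (1 + t)) ^ ?l)
      \<le> (real n * 2 ^ (m - 1)) * (2 * (\<delta> / (2 * real n)) ^ m)"
    using levels t by (intro mult_mono) auto
  also have "\<dots> = \<delta> * (\<delta> / real n) ^ (m - 1)"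
  proof -
    obtain k where "m = Suc k" using m(1) by (cases m) auto
    then show ?thesis using n by (simp add: power_divide power_mult_distrib)
  qed
  also have "\<dots> \<le> \<delta>"
    using \<delta> n by (intro mult_left_le power_le_one) (auto simp: divide_le_eq)
  finally show ?thesis .
qed

text \<open>Keeps the medians away from the empty list; for \<open>\<delta> \<ge> 2 * n\<close> the
  repetition count would be \<open>0\<close>.\<close>

lemma wish_reps_pos:
  assumes "q \<ge> 3" "r = nat \<lfloor>(real q - 1) / 2\<rfloor>" "n \<ge> 1" "0 < \<delta>" "\<delta> < 1"
  shows "wish_reps q r n \<delta> > 0"
proof -
  have "2 * real n / \<delta> > 1" using assms(3-5) by (simp add: less_divide_eq)
  then show ?thesis
    using wish_gamma_pos[OF assms(1,2)] by (simp add: wish_reps_def)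
qed

section \<open>Growth of the number of oracle calls\<close>

lemma wish_calls_bigtheta:
  assumes q: "q \<ge> 3" "r = nat \<lfloor>(real q - 1) / 2\<rfloor>"
  shows "(\<lambda>(n, \<delta>). real (1 + wish_levels q r n * wish_reps q r n \<delta>))
           \<in> \<Theta>[wish_regime](\<lambda>(n, \<delta>). real n * ln (real n / \<delta>))"
proof -
  let ?t = "real q / real r" and ?\<gamma> = "wish_gamma q r"
  \<comment> \<open>For fixed \<open>q\<close> the levels grow like \<open>c * n\<close> and the
    repetitions like \<open>g * ln (n / \<delta>)\<close>.\<close>
  define c where "c = log ?t (real q)"
  define g where "g = 1 / ?\<gamma>"
  have g: "g > 0" using wish_gamma_pos[OF q] by (simp add: g_def)
  have c: "c \<ge> 1"
  proof -
    have "log ?t ?t \<le> log ?t (real q)"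
      using wish_ratio_bounds[OF q] q(1) by (intro log_mono) (auto simp: field_simps)
    moreover have "log ?t ?t = 1"
      using wish_ratio_bounds(5)[OF q] by (intro log_eq_one) auto
    ultimately show ?thesis by (simp add: c_def)
  qed
  \<comment> \<open>Once \<open>ln (n / \<delta>) \<ge> 1\<close>, the additive \<open>ln 2\<close>,
    both roundings and the extra call for \<open>M\<^sub>0\<close> can be absorbed into the
    constants.\<close>
  have ev: "eventually (\<lambda>(n, \<delta>). n \<ge> 1 \<and> \<delta> > 0 \<and> ln (real n / \<delta>) \<ge> 1) wish_regime"
    unfolding wish_regime_def eventually_inf_principal
  proof (rule eventually_mono)
    show "eventually (\<lambda>(n, \<delta>). real n / \<delta> \<ge> exp 1) (filtercomap (\<lambda>(n, \<delta>). real n / \<delta>) at_top)"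
      using eventually_filtercomapI[OF eventually_ge_at_top[of "exp 1"],
          of "\<lambda>(n, \<delta>). real n / \<delta>"] by (simp add: case_prod_unfold)
  qed (auto simp: ln_ge_iff)
  have ceil: "real (nat \<lceil>x\<rceil>) \<le> x + 1" if "x \<ge> 0" for x :: real
    using that by linarith
  have bounds: "g * (real n * L) \<le> real (1 + wish_levels q r n * wish_reps q r n \<delta>)
      \<and> real (1 + wish_levels q r n * wish_reps q r n \<delta>) \<le> (1 + (c + 1) * (2 * g + 1)) * (real n * L)"
    if n: "n \<ge> 1" and \<delta>: "\<delta> > 0" and L: "L = ln (real n / \<delta>)" "L \<ge> 1" for n \<delta> L
  proof -
    have l2: "ln (2 * real n / \<delta>) = ln 2 + L"
      using n \<delta> ln_mult[of 2 "real n / \<delta>"] by (simp add: L)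
    have ln2: "ln 2 \<ge> (0::real)" "ln 2 \<le> (1::real)"
      using ln_add_one_self_le_self[of 1] by auto
    have reps: "real (wish_reps q r n \<delta>) \<ge> g * L" "real (wish_reps q r n \<delta>) \<le> (2 * g + 1) * L"
    proof -
      have "g * L \<le> g * (ln 2 + L)" "g * (ln 2 + L) \<le> g * (2 * L)"
        using g ln2 L by (auto intro!: mult_left_mono)
      moreover have "real (wish_reps q r n \<delta>) \<ge> g * (ln 2 + L)"
        unfolding wish_reps_def g_def[symmetric] l2 by (rule real_nat_ceiling_ge)
      moreover have "real (wish_reps q r n \<delta>) \<le> g * (ln 2 + L) + 1"
        unfolding wish_reps_def g_def[symmetric] l2 using g ln2 L by (intro ceil) auto
      ultimately show "real (wish_reps q r n \<delta>) \<ge> g * L" "real (wish_reps q r n \<delta>) \<le> (2 * g + 1) * L"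
        using L by (auto simp: algebra_simps)
    qed
    have levels: "real (wish_levels q r n) \<ge> real n" "real (wish_levels q r n) \<le> (c + 1) * real n"
    proof -
      have "real n * 1 \<le> real n * c" using c by (intro mult_left_mono) auto
      moreover have "real (wish_levels q r n) \<ge> real n * c"
        unfolding wish_levels_def c_def[symmetric] by (rule real_nat_ceiling_ge)
      moreover have "real (wish_levels q r n) \<le> real n * c + 1"
        unfolding wish_levels_def c_def[symmetric] using c by (intro ceil) auto
      moreover have "1 \<le> real n" "(c + 1) * real n = real n * c + real n"
        using n by (auto simp: algebra_simps)
      ultimately show "real (wish_levels q r n) \<ge> real n" "real (wish_levels q r n) \<le> (c + 1) * real n"
        by linarith+
    qed
    have "g * (real n * L) = real n * (g * L)" by simp
    also have "\<dots> \<le> real (wish_levels q r n) * real (wish_reps q r n \<delta>)"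
      using levels reps g L by (intro mult_mono) auto
    finally have 1: "g * (real n * L) \<le> real (wish_levels q r n) * real (wish_reps q r n \<delta>)" .
    have "real (wish_levels q r n) * real (wish_reps q r n \<delta>) \<le> ((c + 1) * real n) * ((2 * g + 1) * L)"
      using levels reps c by (intro mult_mono) auto
    moreover have "1 \<le> real n * L" using n L mult_mono[of 1 "real n" 1 L] by simp
    ultimately show ?thesis using 1 by (simp add: algebra_simps)
  qed
  show ?thesis
  proof (rule bigthetaI)
    show "(\<lambda>(n, \<delta>). real (1 + wish_levels q r n * wish_reps q r n \<delta>))
        \<in> O[wish_regime](\<lambda>(n, \<delta>). real n * ln (real n / \<delta>))"
    proof (rule bigoI[where c = "1 + (c + 1) * (2 * g + 1)"], rule eventually_mono[OF ev], clarify)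
      fix n :: nat and \<delta> :: real
      assume *: "n \<ge> 1" "\<delta> > 0" "ln (real n / \<delta>) \<ge> 1"
      show "norm (real (1 + wish_levels q r n * wish_reps q r n \<delta>))
          \<le> (1 + (c + 1) * (2 * g + 1)) * norm (real n * ln (real n / \<delta>))"
        using bounds[OF *(1,2) refl *(3)] *(3) by (simp add: abs_mult)
    qed
    show "(\<lambda>(n, \<delta>). real (1 + wish_levels q r n * wish_reps q r n \<delta>))
        \<in> \<Omega>[wish_regime](\<lambda>(n, \<delta>). real n * ln (real n / \<delta>))"
    proof (rule landau_omega.bigI[OF g], rule eventually_mono[OF ev], clarify)
      fix n :: nat and \<delta> :: real
      assume *: "n \<ge> 1" "\<delta> > 0" "ln (real n / \<delta>) \<ge> 1"
      show "g * norm (real n * ln (real n / \<delta>))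
          \<le> norm (real (1 + wish_levels q r n * wish_reps q r n \<delta>))"
        using bounds[OF *(1,2) refl *(3)] *(3) by (simp add: abs_mult)
    qed
  qed
qed

section \<open>Survivors and the output of the algorithm\<close>

text \<open>The order compares indices, so by injectivity exactly \<open>r\<close> field elements
  lie below \<open>\<alpha> r\<close>, and the accepted vectors form a product set.\<close>

lemma enum_vec_less_const:
  fixes \<alpha> :: "nat \<Rightarrow> 'a::{field,finite}"
  assumes \<alpha>: "bij_betw \<alpha> {..<CARD('a)} UNIV" and r: "r < CARD('a)" and v: "v \<in> carrier_vec m"
  shows "enum_vec_less \<alpha> v (\<alpha> r \<cdot>\<^sub>v ones_vec m) \<longleftrightarrow> (\<forall>j<m. v $ j \<in> \<alpha> ` {..<r})"
proof -
  have inj: "a = b" if "\<alpha> a = \<alpha> b" "a < CARD('a)" "b < CARD('a)" for a b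
    using that \<alpha> by (auto simp: bij_betw_def inj_on_def)
  have "enum_less \<alpha> x (\<alpha> r) \<longleftrightarrow> x \<in> \<alpha> ` {..<r}" for x
    using inj r by (force simp: enum_less_def)
  then show ?thesis using v by (auto simp: enum_vec_less_def ones_vec_def)
qed

definition survives ::
  "(nat \<Rightarrow> 'a::{field,finite}) \<Rightarrow> nat \<Rightarrow> nat \<Rightarrow> 'a vec \<Rightarrow> 'a mat \<times> 'a vec \<Rightarrow> bool" where
  "survives \<alpha> r m \<sigma> = (\<lambda>(A, b). enum_vec_less \<alpha> (A *\<^sub>v \<sigma> + b) (\<alpha> r \<cdot>\<^sub>v ones_vec m))"

abbreviation random_affine :: "nat \<Rightarrow> nat \<Rightarrow> ('a::{field,finite} mat \<times> 'a vec) pmf" where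
  "random_affine m n \<equiv> pair_pmf (random_mat m n) (random_vec m)"

lemma set_random_affine: "set_pmf (random_affine m n) = carrier_mat m n \<times> carrier_vec m"
  by (simp add: random_mat_uniform random_vec_uniform)

text \<open>By \<open>random_affine_pair\<close> both probabilities reduce to counting: each
  constrained value has \<open>r ^ m\<close> admissible vectors among \<open>q ^ m\<close>. The
  single-vector case is the marginal that leaves the second value free.\<close>

lemma prob_survives_pair:
  fixes \<alpha> :: "nat \<Rightarrow> 'a::{field,finite}"
  assumes \<alpha>: "bij_betw \<alpha> {..<CARD('a)} UNIV" and r: "r < CARD('a)"
    and st: "\<sigma> \<in> carrier_vec n" "\<tau> \<in> carrier_vec n" "\<sigma> \<noteq> \<tau>"
  shows "measure_pmf.prob (random_affine m n) {\<omega>. survives \<alpha> r m \<sigma> \<omega>} = (real r / real CARD('a)) ^ m"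
    and "measure_pmf.prob (random_affine m n) {\<omega>. survives \<alpha> r m \<sigma> \<omega> \<and> survives \<alpha> r m \<tau> \<omega>}
         = ((real r / real CARD('a)) ^ m)\<^sup>2"
proof -
  let ?q = "CARD('a)"
  let ?C = "carrier_vec m :: 'a vec set"
  let ?G = "{v \<in> ?C. \<forall>j<m. v $ j \<in> \<alpha> ` {..<r}}"
  let ?f = "\<lambda>(A, b). (A *\<^sub>v \<sigma> + b, A *\<^sub>v \<tau> + b)"
  have "inj_on \<alpha> {..<r}"
    using \<alpha> r by (auto simp: bij_betw_def inj_on_def)
  then have G: "card ?G = r ^ m" by (simp add: card_vec_restrict card_image)
  have surv: "survives \<alpha> r m x (A, b) \<longleftrightarrow> A *\<^sub>v x + b \<in> ?G"
    if "A \<in> carrier_mat m n" "b \<in> ?C" for x A b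
  proof -
    have "A *\<^sub>v x + b \<in> ?C" using that by (intro carrier_vecI) simp
    then show ?thesis using enum_vec_less_const[OF \<alpha> r] by (simp add: survives_def)
  qed
  have prob: "measure_pmf.prob (random_affine m n) {\<omega>. Q \<omega>} = card (?C \<times> ?C \<inter> H) / ?q ^ m / ?q ^ m"
    if Q: "\<And>A b. A \<in> carrier_mat m n \<Longrightarrow> b \<in> ?C \<Longrightarrow> Q (A, b) \<longleftrightarrow> ?f (A, b) \<in> H" for Q H
  proof -
    have "measure_pmf.prob (random_affine m n) {\<omega>. Q \<omega>}
        = measure_pmf.prob (random_affine m n) (?f -` H)"
      using Q by (intro measure_pmf.finite_measure_eq_AE)
        (auto simp: AE_measure_pmf_iff set_random_affine simp del: set_pair_pmf)
    also have "\<dots> = measure_pmf.prob (pmf_of_set (?C \<times> ?C)) H"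
      by (simp flip: random_affine_pair[OF st, of m])
    finally show ?thesis
      by (simp add: measure_pmf_of_set card_carrier_vec)
  qed
  have "?C \<times> ?C \<inter> ?G \<times> UNIV = ?G \<times> ?C" by auto
  then show "measure_pmf.prob (random_affine m n) {\<omega>. survives \<alpha> r m \<sigma> \<omega>} = (real r / real ?q) ^ m"
    by (subst prob[of _ "?G \<times> UNIV"])
       (use G in \<open>auto simp: surv card_carrier_vec card_cartesian_product power_divide\<close>)
  have "?C \<times> ?C \<inter> ?G \<times> ?G = ?G \<times> ?G" by auto
  then show "measure_pmf.prob (random_affine m n) {\<omega>. survives \<alpha> r m \<sigma> \<omega> \<and> survives \<alpha> r m \<tau> \<omega>}
      = ((real r / real ?q) ^ m)\<^sup>2"
    by (subst prob[of _ "?G \<times> ?G"])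
       (use G in \<open>auto simp: surv card_cartesian_product power_divide power2_eq_square\<close>)
qed

text \<open>Positive dimension supplies a second vector, so the marginal of a pair can be
  used.\<close>

lemma prob_survives:
  fixes \<alpha> :: "nat \<Rightarrow> 'a::{field,finite}"
  assumes \<alpha>: "bij_betw \<alpha> {..<CARD('a)} UNIV" and r: "r < CARD('a)"
    and st: "\<sigma> \<in> carrier_vec n" "n \<ge> 1"
  shows "measure_pmf.prob (random_affine m n) {\<omega>. survives \<alpha> r m \<sigma> \<omega>} = (real r / real CARD('a)) ^ m"
proof -
  have "\<exists>\<tau>\<in>carrier_vec n. \<tau> \<noteq> \<sigma>"
  proof (cases "\<sigma> = 0\<^sub>v n")
    case True
    then show ?thesis
      using st(2) by (intro bexI[of _ "unit_vec n 0"]) (auto simp: unit_vec_nonzero)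
  next
    case False
    then show ?thesis by (intro bexI[of _ "0\<^sub>v n"]) auto
  qed
  then show ?thesis using prob_survives_pair(1)[OF \<alpha> r st(1)] by metis
qed

definition oracle_value ::
  "(nat \<Rightarrow> 'a::{field,finite}) \<Rightarrow> nat \<Rightarrow> nat \<Rightarrow> ('a vec \<Rightarrow> real) \<Rightarrow> nat \<Rightarrow> 'a mat \<times> 'a vec \<Rightarrow> real" where
  "oracle_value \<alpha> r n w m \<omega> = max_oracle \<alpha> n w (fst \<omega>) (snd \<omega>) (\<alpha> r \<cdot>\<^sub>v ones_vec m)"

lemma wish_query_conv:
  "wish_query \<alpha> r n w m = map_pmf (\<lambda>\<omega>. (oracle_value \<alpha> r n w m \<omega>, 1)) (random_affine m n)"
  by (simp add: wish_query_def oracle_value_def pair_pmf_def map_pmf_def bind_assoc_pmf bind_return_pmf)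

lemma oracle_value_ge:
  assumes "\<sigma> \<in> carrier_vec n" "survives \<alpha> r m \<sigma> \<omega>"
  shows "w \<sigma> \<le> oracle_value \<alpha> r n w m \<omega>"
  using assms by (cases \<omega>) (auto simp: oracle_value_def max_oracle_def Let_def survives_def intro!: Max_ge)

lemma oracle_value_nonneg:
  assumes "\<And>\<sigma>. \<sigma> \<in> carrier_vec n \<Longrightarrow> w \<sigma> \<ge> 0"
  shows "oracle_value \<alpha> r n w m \<omega> \<ge> 0"
proof (cases "\<exists>\<sigma>\<in>carrier_vec n. survives \<alpha> r m \<sigma> \<omega>")
  case True
  then show ?thesis using oracle_value_ge assms by (metis order_trans)
next
  case False
  then show ?thesis
    by (cases \<omega>) (auto simp: oracle_value_def max_oracle_def Let_def survives_def)
qed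

text \<open>Nonnegativity of \<open>B\<close> covers the answer \<open>0\<close> on an empty
  feasible set.\<close>

lemma oracle_value_le:
  assumes "B \<ge> 0" "\<And>\<sigma>. \<sigma> \<in> carrier_vec n \<Longrightarrow> survives \<alpha> r m \<sigma> \<omega> \<Longrightarrow> w \<sigma> \<le> B"
  shows "oracle_value \<alpha> r n w m \<omega> \<le> B"
  using assms by (cases \<omega>) (auto simp: oracle_value_def max_oracle_def Let_def survives_def)

section \<open>Medians per level, union bound and approximation guarantee\<close>

lemma decreasing_enumeration:
  fixes w :: "'a \<Rightarrow> real"
  assumes "finite X"
  obtains g where "bij_betw g {..<card X} X" "\<And>i j. i \<le> j \<Longrightarrow> j < card X \<Longrightarrow> w (g j) \<le> w (g i)"
proof -
  obtain ys where ys: "set ys = X" "distinct ys" using finite_distinct_list[OF assms] by blast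
  define zs where "zs = sort_key (\<lambda>x. - w x) ys"
  have zs: "set zs = X" "distinct zs" "length zs = card X"
    using ys distinct_card[OF ys(2)] by (auto simp: zs_def)
  have "sorted (map (\<lambda>x. - w x) zs)" by (simp add: zs_def)
  then have "w (zs ! j) \<le> w (zs ! i)" if "i \<le> j" "j < card X" for i j
    using that zs sorted_nth_mono[of "map (\<lambda>x. - w x) zs" i j] by simp
  moreover have "bij_betw (\<lambda>i. zs ! i) {..<card X} X"
    by (rule bij_betw_nth) (simp_all only: zs)
  ultimately show thesis by (rule that[rotated])
qed

text \<open>A median outside the window needs at least half of its samples on the same wrong side,
  so each side contributes one majority bound.\<close>

lemma level_failure_prob:
  assumes t: "t > 1" and reps: "wish_reps q r n \<delta> > 0"
    and lo: "measure_pmf.prob (random_affine m n) {\<omega>. oracle_value \<alpha> r n w m \<omega> < lo} \<le> 1 / (1 + t)"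
    and hi: "measure_pmf.prob (random_affine m n) {\<omega>. oracle_value \<alpha> r n w m \<omega> > hi} \<le> 1 / (1 + t)"
  shows "measure_pmf.prob (wish_level \<alpha> q r \<delta> n w m) {x. \<not> (lo \<le> fst x \<and> fst x \<le> hi)}
         \<le> 2 * (2 * sqrt t / (1 + t)) ^ wish_reps q r n \<delta>"
proof -
  let ?l = "wish_reps q r n \<delta>" and ?Q = "wish_query \<alpha> r n w m"
  let ?R = "replicate_pmf ?l ?Q"
  let ?L = "{xs. 2 * length (filter (\<lambda>x. fst x < lo) xs) \<ge> ?l}"
  let ?H = "{xs. 2 * length (filter (\<lambda>x. fst x > hi) xs) \<ge> ?l}"
  have "measure_pmf.prob (wish_level \<alpha> q r \<delta> n w m) {x. \<not> (lo \<le> fst x \<and> fst x \<le> hi)}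
      = measure_pmf.prob ?R {xs. \<not> (lo \<le> median (map fst xs) \<and> median (map fst xs) \<le> hi)}"
    by (simp add: wish_level_def vimage_def)
  also have "\<dots> \<le> measure_pmf.prob ?R (?L \<union> ?H)"
  proof (rule measure_pmf.finite_measure_mono_AE)
    show "AE xs in ?R. xs \<in> {xs. \<not> (lo \<le> median (map fst xs) \<and> median (map fst xs) \<le> hi)}
        \<longrightarrow> xs \<in> ?L \<union> ?H"
      unfolding AE_measure_pmf_iff
    proof (intro ballI impI)
      fix xs assume xs: "xs \<in> set_pmf ?R"
        and "xs \<in> {xs. \<not> (lo \<le> median (map fst xs) \<and> median (map fst xs) \<le> hi)}"
      then have bad: "median (map fst xs) < lo \<or> median (map fst xs) > hi" by auto
      have len: "length xs = ?l" using xs by (simp add: set_replicate_pmf)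
      then have "map fst xs \<noteq> []" using reps by auto
      then show "xs \<in> ?L \<union> ?H"
        using bad len median_lt_imp[of "map fst xs" lo] median_gt_imp[of "map fst xs" hi]
        by (auto simp: filter_map o_def)
    qed
  qed auto
  also have "\<dots> \<le> measure_pmf.prob ?R ?L + measure_pmf.prob ?R ?H"
    by (rule measure_Un_le) auto
  also have "\<dots> \<le> (2 * sqrt t / (1 + t)) ^ ?l + (2 * sqrt t / (1 + t)) ^ ?l"
    using lo hi by (intro add_mono replicate_pmf_majority[OF t]) (simp_all add: wish_query_conv vimage_def)
  finally show ?thesis by simp
qed

lemma mb_wish_success_prob:
  fixes \<alpha> :: "nat \<Rightarrow> 'a::{field,finite}"
  assumes q: "q = CARD('a)" "q \<ge> 3" and \<alpha>: "bij_betw \<alpha> {..<q} UNIV"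
    and r: "r = nat \<lfloor>(real q - 1) / 2\<rfloor>"
    and n: "n \<ge> 1" and \<delta>: "0 < \<delta>" "\<delta> < 1" and w: "\<And>\<sigma>. \<sigma> \<in> carrier_vec n \<Longrightarrow> w \<sigma> \<ge> 0"
  defines "t \<equiv> real q / real r" and "S \<equiv> \<Sum>\<sigma>\<in>carrier_vec n. w \<sigma>"
  shows "measure_pmf.prob (mb_wish \<alpha> q r \<delta> n w) {(Z, calls). S / t\<^sup>2 \<le> Z \<and> Z \<le> t\<^sup>2 * S} \<ge> 1 - \<delta>"
proof -
  let ?X = "carrier_vec n :: 'a vec set"
  let ?N = "card ?X"
  note rb = wish_ratio_bounds[OF q(2) r]
  have t2: "t > 2" using rb(5) by (simp add: t_def)
  have rq: "r < CARD('a)" using rb(2) q(1) by simp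
  have \<alpha>': "bij_betw \<alpha> {..<CARD('a)} UNIV" using \<alpha> q(1) by simp
  obtain g where g: "bij_betw g {..<?N} ?X" "\<And>i j. i \<le> j \<Longrightarrow> j < ?N \<Longrightarrow> w (g j) \<le> w (g i)"
    using decreasing_enumeration[of ?X w] by auto
  have gX: "g k \<in> ?X" if "k < ?N" for k using that g(1) by (auto simp: bij_betw_def)
  have gE: "\<exists>k<?N. \<sigma> = g k" if "\<sigma> \<in> ?X" for \<sigma>
    using that g(1) unfolding bij_betw_def by (metis imageE lessThan_iff)
  \<comment> \<open>Padding with \<open>0\<close> lets ranks run past the number of vectors;
    nonnegative weights keep \<open>f\<close> decreasing.\<close>
  define f where "f k = (if k < ?N then w (g k) else 0)" for k
  have f0: "f k = 0" if "k \<ge> ?N" for k using that by (simp add: f_def)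
  have fnn: "f k \<ge> 0" for k using w gX by (simp add: f_def)
  have fanti: "antimono f"
    using g(2) w gX by (auto simp: antimono_def f_def)
  have S: "S = (\<Sum>k<?N. f k)"
    unfolding S_def using sum.reindex_bij_betw[OF g(1), of w] by (simp add: f_def)
  have M0: "Max (w ` ?X) = f 0"
  proof (rule Max_eqI)
    have N0: "0 < ?N" by (simp add: card_gt_0_iff)
    show "f 0 \<in> w ` ?X" using N0 gX[OF N0] by (auto simp: f_def)
    fix y assume "y \<in> w ` ?X"
    then obtain k where "k < ?N" "y = w (g k)" using gE by auto
    then show "y \<le> f 0" using N0 g(2)[of 0 k] by (simp add: f_def)
  qed simp
  let ?p = "\<lambda>m. (1 / t) ^ m"
  have one: "measure_pmf.prob (random_affine m n) {\<omega>. survives \<alpha> r m \<sigma> \<omega>} = ?p m"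
    if "\<sigma> \<in> ?X" for m \<sigma>
    using prob_survives[OF \<alpha>' rq that n] q(1) by (simp add: t_def)
  have two: "measure_pmf.prob (random_affine m n) {\<omega>. survives \<alpha> r m \<sigma> \<omega> \<and> survives \<alpha> r m \<tau> \<omega>} = (?p m)\<^sup>2"
    if "\<sigma> \<in> ?X" "\<tau> \<in> ?X" "\<sigma> \<noteq> \<tau>" for m \<sigma> \<tau>
    using prob_survives_pair(2)[OF \<alpha>' rq that] q(1) by (simp add: t_def)
  \<comment> \<open>If one of the \<open>K\<close> heaviest vectors survives, the oracle answers at
    least the least of their weights, which has index \<open>K - 1\<close> because ranks start at
    \<open>0\<close>. For \<open>K\<close> beyond the number of vectors that value is
    \<open>0\<close> and the event is empty.\<close>
  have lower: "measure_pmf.prob (random_affine m n) {\<omega>. oracle_value \<alpha> r n w m \<omega> < f (K - 1)}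
      \<le> 1 / (1 + real K * ?p m)" if "K \<ge> 1" for m K
  proof (cases "K \<le> ?N")
    case True
    have inj: "inj_on g {..<K}" using g(1) True by (auto simp: bij_betw_def inj_on_def)
    have "measure_pmf.prob (random_affine m n) {\<omega>. oracle_value \<alpha> r n w m \<omega> < f (K - 1)}
        \<le> measure_pmf.prob (random_affine m n) {\<omega>. \<forall>\<sigma>\<in>g ` {..<K}. \<not> survives \<alpha> r m \<sigma> \<omega>}"
    proof (rule measure_pmf.finite_measure_mono, safe)
      fix \<omega> k assume *: "oracle_value \<alpha> r n w m \<omega> < f (K - 1)" "k < K" "survives \<alpha> r m (g k) \<omega>"
      have "w (g (K - 1)) \<le> w (g k)" using * True by (intro g(2)) auto
      also have "\<dots> \<le> oracle_value \<alpha> r n w m \<omega>"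
        using * True by (intro oracle_value_ge gX) auto
      also have "w (g (K - 1)) = f (K - 1)" using True that by (simp add: f_def)
      finally show False using *(1) by simp
    qed simp
    also have "\<dots> \<le> 1 / (1 + real (card (g ` {..<K})) * ?p m)"
      using gX True t2 by (intro second_moment_none one two) auto
    finally show ?thesis using inj by (simp add: card_image)
  next
    case False
    then have "f (K - 1) = 0" by (intro f0) auto
    then have empty: "{\<omega>. oracle_value \<alpha> r n w m \<omega> < f (K - 1)} = {}"
      using oracle_value_nonneg[of n w \<alpha> r m] w by (auto simp: not_less)
    show ?thesis unfolding empty using t2 by simp
  qed
  \<comment> \<open>An answer above \<open>f K\<close> requires a survivor of index below
    \<open>K\<close>.\<close>
  have upper: "measure_pmf.prob (random_affine m n) {\<omega>. oracle_value \<alpha> r n w m \<omega> > f K}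
      \<le> real K * ?p m" for m K
  proof -
    let ?J = "{..<min K ?N}"
    have "measure_pmf.prob (random_affine m n) {\<omega>. oracle_value \<alpha> r n w m \<omega> > f K}
        \<le> measure_pmf.prob (random_affine m n) (\<Union>k\<in>?J. {\<omega>. survives \<alpha> r m (g k) \<omega>})"
    proof (rule measure_pmf.finite_measure_mono, rule subsetI, rule ccontr)
      fix \<omega> assume *: "\<omega> \<in> {\<omega>. oracle_value \<alpha> r n w m \<omega> > f K}"
        "\<omega> \<notin> (\<Union>k\<in>?J. {\<omega>. survives \<alpha> r m (g k) \<omega>})"
      have "oracle_value \<alpha> r n w m \<omega> \<le> f K"
      proof (rule oracle_value_le[OF fnn])
        fix \<sigma> assume "\<sigma> \<in> ?X" "survives \<alpha> r m \<sigma> \<omega>"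
        then obtain k where k: "k < ?N" "\<sigma> = g k" "survives \<alpha> r m (g k) \<omega>"
          using gE by blast
        then have "K \<le> k" using *(2) by auto
        then show "w \<sigma> \<le> f K" using k g(2)[of K k] by (simp add: f_def)
      qed
      then show False using *(1) by simp
    qed simp
    also have "\<dots> \<le> (\<Sum>k\<in>?J. measure_pmf.prob (random_affine m n) {\<omega>. survives \<alpha> r m (g k) \<omega>})"
      by (rule measure_pmf.finite_measure_subadditive_finite) auto
    also have "\<dots> = real (min K ?N) * ?p m" using gX by (simp add: one)
    also have "\<dots> \<le> real K * ?p m" using t2 by (intro mult_right_mono) auto
    finally show ?thesis .
  qed
  let ?n' = "wish_levels q r n"
  let ?\<epsilon> = "2 * (2 * sqrt t / (1 + t)) ^ wish_reps q r n \<delta>"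
  \<comment> \<open>Index \<open>i\<close> belongs to the level with \<open>m = i + 1\<close> rows,
    so the ranks are \<open>t ^ (m + 1)\<close> and \<open>t ^ (m - 2)\<close>.\<close>
  define lo where "lo i = f (nat \<lceil>t ^ (i + 2)\<rceil> - 1)" for i
  define hi where "hi i = f (nat \<lfloor>t ^ i / t\<rfloor>)" for i
  let ?W = "wish_level \<alpha> q r \<delta> n w"
  have level: "measure_pmf.prob (?W (i + 1)) {x. \<not> (lo i \<le> fst x \<and> fst x \<le> hi i)} \<le> ?\<epsilon>" for i
  proof (rule level_failure_prob)
    show "t > 1" using t2 by simp
    show "wish_reps q r n \<delta> > 0" by (rule wish_reps_pos[OF q(2) r n \<delta>])
    let ?K = "nat \<lceil>t ^ (i + 2)\<rceil>"
    have K: "real ?K \<ge> t ^ (i + 2)" by (rule real_nat_ceiling_ge)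
    have "t ^ (i + 2) > 0" using t2 by simp
    then have "?K \<ge> 1" using K by linarith
    then have "measure_pmf.prob (random_affine (i + 1) n) {\<omega>. oracle_value \<alpha> r n w (i + 1) \<omega> < lo i}
        \<le> 1 / (1 + real ?K * ?p (i + 1))"
      unfolding lo_def by (rule lower)
    \<comment> \<open>The expected number of survivors among the \<open>?K\<close> heaviest vectors
      is at least \<open>t\<close>.\<close>
    also have "t = t ^ (i + 2) * ?p (i + 1)" using t2 by (simp add: power_divide)
    then have "t \<le> real ?K * ?p (i + 1)"
      using mult_right_mono[OF K, of "?p (i + 1)"] t2 by simp
    then have "1 / (1 + real ?K * ?p (i + 1)) \<le> 1 / (1 + t)"
      using t2 by (intro divide_left_mono) auto
    finally show "measure_pmf.prob (random_affine (i + 1) n)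
        {\<omega>. oracle_value \<alpha> r n w (i + 1) \<omega> < lo i} \<le> 1 / (1 + t)" .
    have "measure_pmf.prob (random_affine (i + 1) n) {\<omega>. oracle_value \<alpha> r n w (i + 1) \<omega> > hi i}
        \<le> real (nat \<lfloor>t ^ i / t\<rfloor>) * ?p (i + 1)"
      unfolding hi_def by (rule upper)
    also have "\<dots> \<le> (t ^ i / t) * ?p (i + 1)"
      using t2 by (intro mult_right_mono of_nat_floor) auto
    \<comment> \<open>Since \<open>t > 2\<close>, this is below \<open>1 / (1 + t)\<close>, so both
      sides share one majority bound.\<close>
    also have "\<dots> = 1 / t\<^sup>2" using t2 by (simp add: power_divide power2_eq_square)
    also have "\<dots> \<le> 1 / (1 + t)"
    proof (rule divide_left_mono)
      have "2 * t \<le> t * t" using t2 by (intro mult_right_mono) auto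
      then show "1 + t \<le> t\<^sup>2" unfolding power2_eq_square using t2 by linarith
    qed (use t2 in auto)
    finally show "measure_pmf.prob (random_affine (i + 1) n)
        {\<omega>. oracle_value \<alpha> r n w (i + 1) \<omega> > hi i} \<le> 1 / (1 + t)" .
  qed
  let ?P = "Pi_pmf {1..?n'} (0, 0) ?W"
  let ?bad = "\<lambda>i. {L. \<not> (lo i \<le> fst (L (i + 1)) \<and> fst (L (i + 1)) \<le> hi i)}"
  define Z where "Z L = f 0 + (t - 1) * (\<Sum>i<?n'. fst (L (i + 1)) * t ^ i)" for L :: "nat \<Rightarrow> real \<times> nat"
  have good: "S / t\<^sup>2 \<le> Z L \<and> Z L \<le> t\<^sup>2 * S" if "L \<notin> (\<Union>i<?n'. ?bad i)" for L
  proof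
    have L: "lo i \<le> fst (L (i + 1))" "fst (L (i + 1)) \<le> hi i" if "i < ?n'" for i
      using that \<open>L \<notin> _\<close> by auto
    have "S \<le> t\<^sup>2 * (f 0 + (t - 1) * (\<Sum>i<?n'. lo i * t ^ i))"
      unfolding S lo_def using t2 wish_levels_power_ge[OF q(2) r, of n]
      by (intro sum_le_geometric_samples fanti f0) (auto simp: card_carrier_vec t_def q(1))
    also have "\<dots> \<le> t\<^sup>2 * Z L"
      unfolding Z_def using t2 L by (intro mult_left_mono add_left_mono sum_mono mult_right_mono) auto
    finally show "S / t\<^sup>2 \<le> Z L" using t2 by (simp add: divide_le_eq mult.commute)
    have "Z L \<le> f 0 + (t - 1) * (\<Sum>i<?n'. hi i * t ^ i)"
      unfolding Z_def using t2 L by (intro mult_left_mono add_left_mono sum_mono mult_right_mono) auto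
    also have "\<dots> \<le> t\<^sup>2 * S"
      unfolding S hi_def using t2 by (intro geometric_samples_le_sum fanti f0) auto
    finally show "Z L \<le> t\<^sup>2 * S" .
  qed
  have comp: "measure_pmf.prob ?P (?bad i) \<le> ?\<epsilon>" if "i < ?n'" for i
  proof -
    have "measure_pmf.prob ?P (?bad i)
        = measure_pmf.prob (map_pmf (\<lambda>L. L (i + 1)) ?P) {x. \<not> (lo i \<le> fst x \<and> fst x \<le> hi i)}"
      by (simp add: vimage_def)
    also have "map_pmf (\<lambda>L. L (i + 1)) ?P = ?W (i + 1)"
      using that by (subst Pi_pmf_component) auto
    finally show ?thesis using level by simp
  qed
  have "measure_pmf.prob ?P (\<Union>i<?n'. ?bad i) \<le> (\<Sum>i<?n'. measure_pmf.prob ?P (?bad i))"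
    by (rule measure_pmf.finite_measure_subadditive_finite) auto
  also have "\<dots> \<le> (\<Sum>i<?n'. ?\<epsilon>)" using comp by (intro sum_mono) auto
  also have "\<dots> \<le> \<delta>"
    using wish_union_bound[OF q(2) r n \<delta>] by (simp add: t_def)
  finally have "1 - \<delta> \<le> measure_pmf.prob ?P (- (\<Union>i<?n'. ?bad i))"
    by (subst measure_pmf.prob_compl[of "\<Union>i<?n'. ?bad i" ?P, unfolded space_measure_pmf Compl_eq_Diff_UNIV[symmetric]])
       auto
  also have "\<dots> \<le> measure_pmf.prob ?P {L. S / t\<^sup>2 \<le> Z L \<and> Z L \<le> t\<^sup>2 * S}"
    using good by (intro measure_pmf.finite_measure_mono) auto
  also have "\<dots> = measure_pmf.prob (mb_wish \<alpha> q r \<delta> n w) {(Z, calls). S / t\<^sup>2 \<le> Z \<and> Z \<le> t\<^sup>2 * S}"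
    by (simp add: mb_wish_def Let_def M0 vimage_def Z_def t_def)
  finally show ?thesis .
qed

text \<open>Randomness affects the answers but not the count: one call per query, a fixed number of
  queries per level, and one call for \<open>M\<^sub>0\<close>.\<close>

lemma mb_wish_calls:
  assumes "(Z, calls) \<in> set_pmf (mb_wish \<alpha> q r \<delta> n w)"
  shows "calls = 1 + wish_levels q r n * wish_reps q r n \<delta>"
proof -
  have query: "snd x = 1" if "x \<in> set_pmf (wish_query \<alpha> r n w i)" for x i
    using that by (auto simp: wish_query_conv)
  have level: "snd x = wish_reps q r n \<delta>" if x: "x \<in> set_pmf (wish_level \<alpha> q r \<delta> n w i)" for x i
  proof -
    obtain xs where xs: "xs \<in> set_pmf (replicate_pmf (wish_reps q r n \<delta>) (wish_query \<alpha> r n w i))"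
      "snd x = sum_list (map snd xs)"
      using x by (auto simp: wish_level_def)
    have "map snd xs = replicate (length xs) 1"
      using xs(1) query by (intro replicate_eqI) (auto simp: set_replicate_pmf)
    then show ?thesis using xs by (simp add: set_replicate_pmf sum_list_replicate)
  qed
  obtain L where L: "L \<in> set_pmf (Pi_pmf {1..wish_levels q r n} (0, 0) (wish_level \<alpha> q r \<delta> n w))"
    "calls = 1 + (\<Sum>i=1..wish_levels q r n. snd (L i))"
    using assms by (auto simp: mb_wish_def Let_def)
  have "snd (L i) = wish_reps q r n \<delta>" if "i \<in> {1..wish_levels q r n}" for i
    using L(1) that by (intro level[of _ i]) (auto simp: set_Pi_pmf PiE_dflt_def)
  then show ?thesis using L(2) by simp
qed

theorem theorem1:
  fixes \<alpha> :: "nat \<Rightarrow> 'a::{field,finite}" and q r :: nat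
  assumes "q = CARD('a)" and "q \<ge> 3"
    and "bij_betw \<alpha> {..<q} UNIV"
    and "r = nat \<lfloor>(real q - 1) / 2\<rfloor>"
  shows "(\<exists>T :: nat \<times> real \<Rightarrow> nat.
            (\<forall>n \<delta> w. n \<ge> 1 \<longrightarrow> \<delta> > 0 \<longrightarrow> (\<forall>\<sigma>\<in>carrier_vec n. w \<sigma> \<ge> 0) \<longrightarrow>
               (\<forall>(Z, calls)\<in>set_pmf (mb_wish \<alpha> q r \<delta> n w). calls = T (n, \<delta>))) \<and>
            (\<lambda>p. real (T p)) \<in> \<Theta>[wish_regime](\<lambda>(n, \<delta>). real n * ln (real n / \<delta>))) \<and>
         (\<forall>n \<delta> w. n \<ge> 1 \<longrightarrow> \<delta> > 0 \<longrightarrow> (\<forall>\<sigma>\<in>carrier_vec n. w \<sigma> \<ge> 0) \<longrightarrow>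
            (let S = (\<Sum>\<sigma>\<in>carrier_vec n. w \<sigma>); t = real q / real r
             in measure_pmf.prob (mb_wish \<alpha> q r \<delta> n w)
                  {(Z, calls). S / t\<^sup>2 \<le> Z \<and> Z \<le> t\<^sup>2 * S} \<ge> 1 - \<delta>))"
proof (intro conjI exI[of _ "\<lambda>(n, \<delta>). 1 + wish_levels q r n * wish_reps q r n \<delta>"] allI impI)
  fix n and \<delta> :: real and w :: "'a vec \<Rightarrow> real"
  show "\<forall>(Z, calls)\<in>set_pmf (mb_wish \<alpha> q r \<delta> n w).
      calls = (case (n, \<delta>) of (n, \<delta>) \<Rightarrow> 1 + wish_levels q r n * wish_reps q r n \<delta>)"
    by (auto dest: mb_wish_calls)
next
  show "(\<lambda>p. real (case p of (n, \<delta>) \<Rightarrow> 1 + wish_levels q r n * wish_reps q r n \<delta>))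
      \<in> \<Theta>[wish_regime](\<lambda>(n, \<delta>). real n * ln (real n / \<delta>))"
    using wish_calls_bigtheta[OF assms(2,4)] by (simp add: case_prod_unfold)
next
  fix n and \<delta> :: real and w :: "'a vec \<Rightarrow> real"
  assume *: "n \<ge> 1" "\<delta> > 0" "\<forall>\<sigma>\<in>carrier_vec n. w \<sigma> \<ge> 0"
  show "let S = (\<Sum>\<sigma>\<in>carrier_vec n. w \<sigma>); t = real q / real r
      in measure_pmf.prob (mb_wish \<alpha> q r \<delta> n w) {(Z, calls). S / t\<^sup>2 \<le> Z \<and> Z \<le> t\<^sup>2 * S} \<ge> 1 - \<delta>"
  \<comment> \<open>For \<open>\<delta> \<ge> 1\<close> the required probability is not
    positive.\<close>
  proof (cases "\<delta> < 1")
    case True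
    then show ?thesis
      unfolding Let_def using * by (intro mb_wish_success_prob assms) auto
  next
    case False
    then have "1 - \<delta> \<le> 0" by simp
    then show ?thesis unfolding Let_def by (rule order_trans) simp
  qed
qed

end
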